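(* Fix $d\ge1$, $\sigma>0$ and $K>0$. Let $\mathcal{G}_\sigma\in\mathcal{P}_1(\mathbb{R}^d)$ have a density $g_\sigma(x)=\prod_{j=1}^d\tilde g_\sigma(x_j)$, where $\tilde g_\sigma$ is a probability density on $\mathbb{R}$ that is $\sigma$-subgaussian, bounded, and monotonically decreases as its argument goes away from zero in either direction. Let $\mu\in\mathcal{P}_1(\mathbb{R}^d)$ be $K$-subgaussian, denote $\mathcal{X}=\mathrm{supp}(\mu)$, and suppose $\mathsf{diam}(\mathcal{X})<\infty$, where $\mathsf{diam}(\mathcal{X})=\sup_{x\ne y\in\mathcal{X}}\|x-y\|$. Then for any $t>0$ (and every $n\ge1$), $$\mathbb{P}_{\mu^{\otimes n}}\left(\Big|\mathsf{W}_1^{(\mathcal{G}_\sigma)}(\hat\mu_n,\mu)-\mathbb{E}\,\mathsf{W}_1^{(\mathcal{G}_\sigma)}(\hat\mu_n,\mu)\Big|\ge t\right)\le 2e^{-\frac{2t^2n}{\mathsf{diam}(\mathcal{X})^2}}.$$ Consequently, for every sequence $(a_n)_{n\in\mathbb{N}}$ of positive reals with $a_n\in\omega\left(\frac{\log n}{\sqrt n}\right)$, $$\mathbb{P}_{\mu^{\otimes n}}\left(\mathsf{W}_1^{(\mathcal{G}_\sigma)}(\hat\mu_n,\mu)\ge a_n\right)\le\frac{1}{\mathsf{poly}(n)}.$$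
   Context: $\mathcal{P}_1(\mathbb{R}^d)$ is the set of Borel probability measures on $\mathbb{R}^d$ with finite first moment; $\|\cdot\|$ is the Euclidean norm. A probability measure $\mu\in\mathcal{P}_1(\mathbb{R}^d)$ is $K$-subgaussian if for every $\alpha\in\mathbb{R}^d$, $X\sim\mu$ satisfies $\mathbb{E}_\mu[e^{\alpha^T(X-\mathbb{E}X)}]\le e^{\frac12K^2\|\alpha\|^2}$. A density is called $\sigma$-subgaussian if the probability measure it defines is. "Monotonically decreases away from zero in either direction" means $\tilde g_\sigma(s)\ge\tilde g_\sigma(t)$ whenever $0\le s\le t$ or $t\le s\le0$. $\hat\mu_n=\frac1n\sum_{i=1}^n\delta_{X_i}$ is the empirical measure of $(X_1,\dots,X_n)\sim\mu^{\otimes n}$ (i.i.d. samples from $\mu$). $\mathsf{W}_1(\alpha,\beta)=\inf_{\pi}\int\|x-y\|\,d\pi(x,y)$, the infimum over all couplings $\pi$ of $\alpha$ and $\beta$, and $\mathsf{W}_1^{(\mathcal{G}_\sigma)}(\mu,\nu)=\mathsf{W}_1(\mu\ast\mathcal{G}_\sigma,\nu\ast\mathcal{G}_\sigma)$ with $\ast$ denoting convolution of measures. $a_n\in\omega(b_n)$ means $a_n/b_n\to\infty$. A bound by $1/\mathsf{poly}(n)$ means that there is $k>0$ such that the probability is at most $n^{-k}$ for all sufficiently large $n$. *)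

theory Defs
  imports "HOL-Probability.Probability"
begin

definition P1 :: "'a::euclidean_space measure set" where
  "P1 = {M. prob_space M \<and> sets M = sets borel \<and> integrable M norm}"

(* The exponential moments are taken in the extended nonnegative reals, so the bound
   includes their finiteness. *)
definition subgaussian :: "real \<Rightarrow> 'a::euclidean_space measure \<Rightarrow> bool" where
  "subgaussian K M \<longleftrightarrow> M \<in> P1 \<and>
     (\<forall>a. (\<integral>\<^sup>+x. ennreal (exp (a \<bullet> (x - (\<integral>y. y \<partial>M)))) \<partial>M)
           \<le> ennreal (exp (K\<^sup>2 * (norm a)\<^sup>2 / 2)))"

definition probability_density :: "(real \<Rightarrow> real) \<Rightarrow> bool" where
  "probability_density g \<longleftrightarrow> g \<in> borel_measurable borel \<and> (\<forall>s. 0 \<le> g s) \<and>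
     (\<integral>\<^sup>+s. ennreal (g s) \<partial>lborel) = 1"

definition supp :: "'a::topological_space measure \<Rightarrow> 'a set" where
  "supp M = {x. \<forall>U. open U \<longrightarrow> x \<in> U \<longrightarrow> 0 < emeasure M U}"

definition empirical_measure :: "nat \<Rightarrow> (nat \<Rightarrow> 'a::topological_space) \<Rightarrow> 'a measure" where
  "empirical_measure n x =
     measure_of UNIV (sets borel) (\<lambda>A. (\<Sum>i<n. emeasure (return borel (x i)) A) / of_nat n)"

(* measure_of yields the null measure when its set function is not a measure;
   this lemma rules that out. *)
lemma emeasure_empirical_measure:
  assumes "n \<ge> 1" and A: "A \<in> sets borel"
  shows "emeasure (empirical_measure n x) A
           = (\<Sum>i<n. emeasure (return borel (x i)) A) / of_nat n"
proof -
  define f where "f = (\<lambda>A. (\<Sum>i<n. emeasure (return borel (x i)) A) / of_nat n)"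
  have "countably_additive (sets borel) f"
    unfolding countably_additive_def f_def
  proof (intro allI impI)
    fix B :: "nat \<Rightarrow> 'a set"
    assume B: "range B \<subseteq> sets borel" "disjoint_family B" "\<Union>(range B) \<in> sets borel"
    have "(\<Sum>k. (\<Sum>i<n. emeasure (return borel (x i)) (B k)) / of_nat n)
        = (\<Sum>k. \<Sum>i<n. emeasure (return borel (x i)) (B k)) / of_nat n"
      by simp
    also have "(\<Sum>k. \<Sum>i<n. emeasure (return borel (x i)) (B k))
        = (\<Sum>i<n. \<Sum>k. emeasure (return borel (x i)) (B k))"
      by (rule suminf_sum) simp
    also have "\<dots> = (\<Sum>i<n. emeasure (return borel (x i)) (\<Union>(range B)))"
      using B by (intro sum.cong refl suminf_emeasure) auto
    finally show "(\<Sum>k. (\<Sum>i<n. emeasure (return borel (x i)) (B k)) / of_nat n)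
        = (\<Sum>i<n. emeasure (return borel (x i)) (\<Union>(range B))) / of_nat n" .
  qed
  moreover have "positive (sets borel) f"
    by (simp add: positive_def f_def)
  ultimately have "emeasure (measure_of UNIV (sets borel) f) A = f A"
    using A sets.sigma_algebra_axioms[of "borel :: 'a measure"]
    by (intro emeasure_measure_of_sigma) auto
  then show ?thesis
    by (simp add: empirical_measure_def f_def)
qed

definition couplings :: "'a::euclidean_space measure \<Rightarrow> 'a measure \<Rightarrow> ('a \<times> 'a) measure set" where
  "couplings M N = {\<pi>. prob_space \<pi> \<and> sets \<pi> = sets (borel \<Otimes>\<^sub>M borel) \<and>
     distr \<pi> borel fst = M \<and> distr \<pi> borel snd = N}"

definition wasserstein1 :: "'a::euclidean_space measure \<Rightarrow> 'a measure \<Rightarrow> ennreal" where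
  "wasserstein1 M N = (INF \<pi>\<in>couplings M N. \<integral>\<^sup>+z. ennreal (norm (fst z - snd z)) \<partial>\<pi>)"

(* The first argument is the smoothing measure.  For M, N, G in P1 the convolutions are
   again in P1, where wasserstein1 is finite, so enn2real loses nothing. *)
definition smooth_wasserstein1 ::
    "'a::ordered_euclidean_space measure \<Rightarrow> 'a measure \<Rightarrow> 'a measure \<Rightarrow> real" where
  "smooth_wasserstein1 G M N = enn2real (wasserstein1 (convolution M G) (convolution N G))"

end

theory Submission
  imports Defs
begin

text \<open>
  Regard the smoothed distance between the empirical measure and \<mu> as a function L of the sample. Two
  properties of L carry the proof.

  First, moving the sample from y to x changes L by at most the average of norm (x i - y i)
  (lemma smooth_wasserstein1_lipschitz). The smoothed empirical measure is a mixture of translates of the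
  smoothing density. A coupling of it with another measure can be followed by translating each component,
  because the conditional probability of belonging to a component is an explicit ratio of densities
  (lemma wasserstein1_transport_mixture). The Lipschitz bound makes L continuous, hence measurable, and
  shows that exchanging one sample point within the support of \<mu>, of diameter D, changes L by at most
  D / n. McDiarmid's inequality (theorem mcdiarmid) then yields the concentration bound with the exponent
  2 t^2 n / D^2.

  Second, the mean of L is at most B / sqrt n for some constant B (lemma expected_smooth_wasserstein1_le).
  Transporting only the difference of two densities p and q costs at most the integral of
  norm z * abs (p z - q z) (lemma wasserstein1_le_weighted_l1). For fixed z the smoothed empirical density
  is an average of n independent variables with mean the smoothed density of \<mu>, so its mean absolute
  deviation is at most H z / sqrt n for every almost sure bound H z of these variables. Since \<mu> lives on
  a bounded set and the factors of the smoothing density decrease away from zero, H can be taken as a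
  product of envelopes that are constant near zero and translates of the factor farther out. The function
  norm z * H z is integrable because the factor has a finite first moment.

  A sequence growing faster than log n / sqrt n eventually exceeds twice the mean, and the concentration
  bound at half its value decays faster than every power of n.
\<close>

section \<open>McDiarmid's bounded-difference inequality\<close>

text \<open>
  Averaging out one coordinate at a time leaves a function F of the others that has the same mean and
  inherits the bounded differences. With the other coordinates fixed, the integrated one moves f within
  an interval of length c i around its mean F, so Hoeffding's lemma contributes the factor exp (s^2 (c i)^2 / 8), and the induction hypothesis takes care of F.
\<close>

lemma mcdiarmid_mgf:
  fixes f :: "('i \<Rightarrow> 'a) \<Rightarrow> real" and c :: "'i \<Rightarrow> real"
  assumes "finite I" and M: "\<And>i. prob_space (M i)" and s: "s > 0"
    and "f \<in> borel_measurable (PiM I M)"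
    and "\<And>x. x \<in> space (PiM I M) \<Longrightarrow> \<bar>f x\<bar> \<le> B"
    and "\<And>i x y. i \<in> I \<Longrightarrow> x \<in> space (PiM I M) \<Longrightarrow> y \<in> space (M i) \<Longrightarrow> f x - f (x(i := y)) \<le> c i"
  shows "(\<integral>\<^sup>+x. ennreal (exp (s * (f x - (\<integral>x. f x \<partial>PiM I M)))) \<partial>PiM I M)
           \<le> ennreal (exp (s\<^sup>2 * (\<Sum>i\<in>I. (c i)\<^sup>2) / 8))"
  using assms(1,4-)
proof (induction I arbitrary: f rule: finite_induct)
  case empty
  show ?case
    by (simp add: PiM_empty nn_integral_count_space_finite lebesgue_integral_count_space_finite)
next
  case (insert i I)
  interpret product_sigma_finite M
    using M by (simp add: product_sigma_finite_def prob_space_imp_sigma_finite)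
  interpret Mi: prob_space "M i" by (rule M)
  interpret PI: prob_space "PiM I M" by (rule prob_space_PiM) (rule M)
  interpret PiI: prob_space "PiM (insert i I) M" by (rule prob_space_PiM) (rule M)
  note [measurable] = insert.prems(1)
  define F where "F x = (\<integral>y. f (x(i := y)) \<partial>M i)" for x
  have upd: "x(i := y) \<in> space (PiM (insert i I) M)"
    if "x \<in> space (PiM I M)" "y \<in> space (M i)" for x y
    using that by (auto simp: space_PiM PiE_def extensional_def)
  have m2[measurable]: "(\<lambda>(x, y). f (x(i := y))) \<in> borel_measurable (PiM I M \<Otimes>\<^sub>M M i)"
    by measurable
  have mx[measurable]: "(\<lambda>y. f (x(i := y))) \<in> borel_measurable (M i)" if "x \<in> space (PiM I M)" for x
    using measurable_Pair2[OF m2 that] by simp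
  have mF[measurable]: "F \<in> borel_measurable (PiM I M)"
    unfolding F_def by measurable
  have intx: "integrable (M i) (\<lambda>y. f (x(i := y)))" if "x \<in> space (PiM I M)" for x
    by (rule Mi.integrable_const_bound[where B = B])
       (use that in \<open>auto intro!: AE_I2 insert.prems(2) upd\<close>)
  have intf: "integrable (PiM (insert i I) M) f"
    by (rule PiI.integrable_const_bound[where B = B]) (auto intro!: AE_I2 insert.prems(2))
  have EF: "(\<integral>x. F x \<partial>PiM I M) = (\<integral>x. f x \<partial>PiM (insert i I) M)"
    unfolding F_def by (rule product_integral_insert[symmetric]) (use insert.hyps intf in auto)
  have IH: "(\<integral>\<^sup>+x. ennreal (exp (s * (F x - (\<integral>x. F x \<partial>PiM I M)))) \<partial>PiM I M)
           \<le> ennreal (exp (s\<^sup>2 * (\<Sum>i\<in>I. (c i)\<^sup>2) / 8))"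
  proof (rule insert.IH)
    show "\<bar>F x\<bar> \<le> B" if x: "x \<in> space (PiM I M)" for x
    proof -
      have "\<bar>F x\<bar> \<le> (\<integral>y. \<bar>f (x(i := y))\<bar> \<partial>M i)"
        unfolding F_def by (rule integral_abs_bound)
      also have "\<dots> \<le> B"
        by (rule Mi.integral_le_const) (use x intx in \<open>auto intro!: AE_I2 insert.prems(2) upd\<close>)
      finally show ?thesis .
    qed
    show "F x - F (x(j := y)) \<le> c j"
      if x: "x \<in> space (PiM I M)" and j: "j \<in> I" and y: "y \<in> space (M j)" for j x y
    proof -
      have x': "x(j := y) \<in> space (PiM I M)"
        using x y j by (auto simp: space_PiM PiE_def extensional_def)
      have ji: "j \<noteq> i" using j insert.hyps by auto
      have "F x - F (x(j := y)) = (\<integral>w. f (x(i := w)) - f ((x(j := y))(i := w)) \<partial>M i)"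
        unfolding F_def by (rule Bochner_Integration.integral_diff[symmetric]) (intro intx x x')+
      also have "\<dots> \<le> c j"
      proof (rule Mi.integral_le_const)
        show "integrable (M i) (\<lambda>w. f (x(i := w)) - f ((x(j := y))(i := w)))"
          by (intro Bochner_Integration.integrable_diff intx x x')
        show "AE w in M i. f (x(i := w)) - f ((x(j := y))(i := w)) \<le> c j"
        proof (rule AE_I2)
          fix w assume w: "w \<in> space (M i)"
          show "f (x(i := w)) - f ((x(j := y))(i := w)) \<le> c j"
            unfolding fun_upd_twist[OF ji] by (rule insert.prems(3)[OF insertI2[OF j] upd[OF x w] y])
        qed
      qed
      finally show ?thesis .
    qed
  qed measurable
  have step: "(\<integral>\<^sup>+y. ennreal (exp (s * (f (x(i := y)) - F x))) \<partial>M i) \<le> ennreal (exp (s\<^sup>2 * (c i)\<^sup>2 / 8))"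
    if x: "x \<in> space (PiM I M)" for x
  proof -
    \<comment> \<open>The hypothesis bounds the oscillation only; the infimum serves as the lower end of the interval
       of length c i that Hoeffding's lemma asks for.\<close>
    define a where "a = (INF y\<in>space (M i). f (x(i := y)))"
    have bb: "bdd_below ((\<lambda>y. f (x(i := y))) ` space (M i))"
    proof (rule bdd_belowI[where m = "- B"], elim imageE)
      fix v y assume "v = f (x(i := y))" "y \<in> space (M i)"
      then show "- B \<le> v" using insert.prems(2)[OF upd[OF x], of y] by linarith
    qed
    have "f (x(i := y)) \<in> {a..a + c i}" if y: "y \<in> space (M i)" for y
    proof -
      have "a \<le> f (x(i := y))"
        unfolding a_def by (rule cINF_lower[OF bb y])
      moreover have "f (x(i := y)) - c i \<le> a"
        unfolding a_def
      proof (rule cINF_greatest)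
        show "space (M i) \<noteq> {}" using y by auto
        fix w assume w: "w \<in> space (M i)"
        show "f (x(i := y)) - c i \<le> f (x(i := w))"
          using insert.prems(3)[OF insertI1 upd[OF x y] w] unfolding fun_upd_upd by linarith
      qed
      ultimately show ?thesis by simp
    qed
    then interpret interval_bounded_random_variable "M i" "\<lambda>y. f (x(i := y))" a "a + c i"
      by unfold_locales (use x in \<open>auto intro!: AE_I2\<close>)
    show ?thesis
      using Hoeffdings_lemma_nn_integral[OF s] by (simp add: F_def)
  qed
  have "(\<integral>\<^sup>+x. ennreal (exp (s * (f x - (\<integral>x. f x \<partial>PiM (insert i I) M)))) \<partial>PiM (insert i I) M)
      = (\<integral>\<^sup>+x. \<integral>\<^sup>+y. ennreal (exp (s * (f (x(i := y)) - (\<integral>x. F x \<partial>PiM I M)))) \<partial>M i \<partial>PiM I M)"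
    unfolding EF by (rule product_nn_integral_insert) (use insert.hyps in auto)
  also have "\<dots> = (\<integral>\<^sup>+x. \<integral>\<^sup>+y. ennreal (exp (s * (F x - (\<integral>x. F x \<partial>PiM I M))))
                 * ennreal (exp (s * (f (x(i := y)) - F x))) \<partial>M i \<partial>PiM I M)"
    by (intro nn_integral_cong) (simp add: algebra_simps flip: ennreal_mult exp_add)
  also have "\<dots> = (\<integral>\<^sup>+x. ennreal (exp (s * (F x - (\<integral>x. F x \<partial>PiM I M))))
                 * (\<integral>\<^sup>+y. ennreal (exp (s * (f (x(i := y)) - F x))) \<partial>M i) \<partial>PiM I M)"
    by (intro nn_integral_cong nn_integral_cmult) measurable
  also have "\<dots> \<le> (\<integral>\<^sup>+x. ennreal (exp (s * (F x - (\<integral>x. F x \<partial>PiM I M))))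
                 * ennreal (exp (s\<^sup>2 * (c i)\<^sup>2 / 8)) \<partial>PiM I M)"
    by (intro nn_integral_mono mult_left_mono step) auto
  also have "\<dots> = (\<integral>\<^sup>+x. ennreal (exp (s * (F x - (\<integral>x. F x \<partial>PiM I M)))) \<partial>PiM I M)
                 * ennreal (exp (s\<^sup>2 * (c i)\<^sup>2 / 8))"
    by (rule nn_integral_multc) measurable
  also have "\<dots> \<le> ennreal (exp (s\<^sup>2 * (\<Sum>i\<in>I. (c i)\<^sup>2) / 8)) * ennreal (exp (s\<^sup>2 * (c i)\<^sup>2 / 8))"
    by (intro mult_right_mono IH) auto
  also have "\<dots> = ennreal (exp (s\<^sup>2 * (\<Sum>i\<in>insert i I. (c i)\<^sup>2) / 8))"
    using insert.hyps by (simp add: algebra_simps add_divide_distrib flip: ennreal_mult exp_add)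
  finally show ?case .
qed

lemma mcdiarmid_upper:
  fixes f :: "('i \<Rightarrow> 'a) \<Rightarrow> real" and c :: "'i \<Rightarrow> real"
  assumes I: "finite I" and M: "\<And>i. prob_space (M i)"
    and f[measurable]: "f \<in> borel_measurable (PiM I M)"
    and B: "\<And>x. x \<in> space (PiM I M) \<Longrightarrow> \<bar>f x\<bar> \<le> B"
    and c: "\<And>i x y. i \<in> I \<Longrightarrow> x \<in> space (PiM I M) \<Longrightarrow> y \<in> space (M i) \<Longrightarrow> f x - f (x(i := y)) \<le> c i"
    and pos: "0 < (\<Sum>i\<in>I. (c i)\<^sup>2)" and t: "t > 0"
  shows "\<P>(x in PiM I M. f x - (\<integral>x. f x \<partial>PiM I M) \<ge> t) \<le> exp (- (2 * t\<^sup>2 / (\<Sum>i\<in>I. (c i)\<^sup>2)))"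
proof -
  interpret P: prob_space "PiM I M" by (rule prob_space_PiM) (rule M)
  define V where "V = (\<Sum>i\<in>I. (c i)\<^sup>2)"
  \<comment> \<open>This s minimises the Chernoff exponent s^2 V / 8 - s t.\<close>
  define s where "s = 4 * t / V"
  have s: "s > 0" using pos t by (simp add: s_def V_def)
  have "emeasure (PiM I M) {x\<in>space (PiM I M). f x - (\<integral>x. f x \<partial>PiM I M) \<ge> t}
     \<le> ennreal (exp (- s * t)) * (\<integral>\<^sup>+x\<in>space (PiM I M). ennreal (exp (s * (f x - (\<integral>x. f x \<partial>PiM I M)))) \<partial>PiM I M)"
    by (rule Chernoff_ineq_nn_integral_ge) (use s in auto)
  also have "(\<integral>\<^sup>+x\<in>space (PiM I M). ennreal (exp (s * (f x - (\<integral>x. f x \<partial>PiM I M)))) \<partial>PiM I M)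
     = (\<integral>\<^sup>+x. ennreal (exp (s * (f x - (\<integral>x. f x \<partial>PiM I M)))) \<partial>PiM I M)"
    by (intro nn_integral_cong) auto
  also have "ennreal (exp (- s * t)) * \<dots> \<le> ennreal (exp (- s * t)) * ennreal (exp (s\<^sup>2 * V / 8))"
    unfolding V_def by (intro mult_left_mono mcdiarmid_mgf[where B = B] I M s f B c) auto
  also have "\<dots> = ennreal (exp (- (2 * t\<^sup>2 / V)))"
    using pos by (simp add: s_def V_def field_simps power2_eq_square flip: ennreal_mult exp_add)
  finally show ?thesis
    unfolding V_def by (simp add: P.emeasure_eq_measure)
qed

theorem mcdiarmid:
  fixes f :: "('i \<Rightarrow> 'a) \<Rightarrow> real" and c :: "'i \<Rightarrow> real"
  assumes I: "finite I" and M: "\<And>i. prob_space (M i)"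
    and f[measurable]: "f \<in> borel_measurable (PiM I M)"
    and B: "\<And>x. x \<in> space (PiM I M) \<Longrightarrow> \<bar>f x\<bar> \<le> B"
    and c: "\<And>i x y. i \<in> I \<Longrightarrow> x \<in> space (PiM I M) \<Longrightarrow> y \<in> space (M i) \<Longrightarrow> \<bar>f x - f (x(i := y))\<bar> \<le> c i"
    and pos: "0 < (\<Sum>i\<in>I. (c i)\<^sup>2)" and t: "t > 0"
  shows "\<P>(x in PiM I M. \<bar>f x - (\<integral>x. f x \<partial>PiM I M)\<bar> \<ge> t) \<le> 2 * exp (- (2 * t\<^sup>2 / (\<Sum>i\<in>I. (c i)\<^sup>2)))"
proof -
  interpret P: prob_space "PiM I M" by (rule prob_space_PiM) (rule M)
  let ?E = "\<integral>x. f x \<partial>PiM I M"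
  have "{x\<in>space (PiM I M). \<bar>f x - ?E\<bar> \<ge> t}
     = {x\<in>space (PiM I M). f x - ?E \<ge> t} \<union> {x\<in>space (PiM I M). - f x - (\<integral>x. - f x \<partial>PiM I M) \<ge> t}"
    by auto
  then have "\<P>(x in PiM I M. \<bar>f x - ?E\<bar> \<ge> t)
     \<le> \<P>(x in PiM I M. f x - ?E \<ge> t) + \<P>(x in PiM I M. - f x - (\<integral>x. - f x \<partial>PiM I M) \<ge> t)"
    by (simp add: measure_Un_le)
  also have "\<dots> \<le> exp (- (2 * t\<^sup>2 / (\<Sum>i\<in>I. (c i)\<^sup>2))) + exp (- (2 * t\<^sup>2 / (\<Sum>i\<in>I. (c i)\<^sup>2)))"
  proof (intro add_mono mcdiarmid_upper[where B = B] I M f B pos t)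
    show "f x - f (x(i := y)) \<le> c i" "- f x - - f (x(i := y)) \<le> c i"
      if "i \<in> I" "x \<in> space (PiM I M)" "y \<in> space (M i)" for i x y
      using c[OF that] by auto
  qed (use B in auto)
  finally show ?thesis by simp
qed

section \<open>Upper bounds for the Wasserstein distance\<close>

text \<open>
  A coupling is often easiest to describe by two random variables X and Y on an auxiliary space with
  more coordinates than the pair itself, for instance a label saying which of several moves is made.
\<close>

lemma wasserstein1_le_realisation:
  fixes X Y :: "'b \<Rightarrow> 'a::euclidean_space"
  assumes [measurable]: "X \<in> borel_measurable \<nu>" "Y \<in> borel_measurable \<nu>"
    and X: "distr \<nu> borel X = P" and Y: "distr \<nu> borel Y = Q" and P: "prob_space P"
  shows "wasserstein1 P Q \<le> (\<integral>\<^sup>+w. ennreal (norm (X w - Y w)) \<partial>\<nu>)"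
proof -
  define \<pi> where "\<pi> = distr \<nu> (borel \<Otimes>\<^sub>M borel) (\<lambda>w. (X w, Y w))"
  have "emeasure \<nu> (space \<nu>) = emeasure P (space P)"
    unfolding X[symmetric] by (simp add: emeasure_distr)
  then have "prob_space \<nu>"
    using P by (auto intro: prob_spaceI simp: prob_space.emeasure_space_1)
  then have "prob_space \<pi>"
    unfolding \<pi>_def by (rule prob_space.prob_space_distr) measurable
  moreover have "distr \<pi> borel fst = P" "distr \<pi> borel snd = Q"
    unfolding \<pi>_def X[symmetric] Y[symmetric] by (simp_all add: distr_distr comp_def)
  ultimately have "\<pi> \<in> couplings P Q"
    by (simp add: couplings_def \<pi>_def)
  then have "wasserstein1 P Q \<le> (\<integral>\<^sup>+z. ennreal (norm (fst z - snd z)) \<partial>\<pi>)"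
    unfolding wasserstein1_def by (rule INF_lower)
  also have "\<dots> = (\<integral>\<^sup>+w. ennreal (norm (X w - Y w)) \<partial>\<nu>)"
    unfolding \<pi>_def by (subst nn_integral_distr) auto
  finally show ?thesis .
qed

lemma coupling_nn_integral_marginals:
  assumes "\<pi> \<in> couplings P Q" and [measurable]: "f \<in> borel_measurable borel"
  shows "(\<integral>\<^sup>+z. f (fst z) \<partial>\<pi>) = (\<integral>\<^sup>+x. f x \<partial>P)" "(\<integral>\<^sup>+z. f (snd z) \<partial>\<pi>) = (\<integral>\<^sup>+x. f x \<partial>Q)"
proof -
  have [measurable_cong]: "sets \<pi> = sets (borel \<Otimes>\<^sub>M borel)"
    using assms by (simp add: couplings_def)
  have P: "P = distr \<pi> borel fst" and Q: "Q = distr \<pi> borel snd"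
    using assms by (simp_all add: couplings_def)
  show "(\<integral>\<^sup>+z. f (fst z) \<partial>\<pi>) = (\<integral>\<^sup>+x. f x \<partial>P)" "(\<integral>\<^sup>+z. f (snd z) \<partial>\<pi>) = (\<integral>\<^sup>+x. f x \<partial>Q)"
    unfolding P Q by (simp_all add: nn_integral_distr)
qed

text \<open>
  This is the triangle inequality for the case where P is a mixture with components p i and P' arises by
  moving the i-th component along T i. Gluing this transport plan to a coupling of P and Q
  would in general call for a disintegration. Here the conditional law of the component given
  the point x is known: it is i with probability w i x = p i x / (sum of all p j x). So a coupling
  of P' and Q is obtained from a pair (x, y) coupling P and Q by drawing i with these weights
  and replacing x by T i x.
\<close>

lemma wasserstein1_transport_mixture:
  fixes p :: "'i \<Rightarrow> 'a::euclidean_space \<Rightarrow> real" and T :: "'i \<Rightarrow> 'a \<Rightarrow> 'a" and c :: "'i \<Rightarrow> real"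
  assumes I: "finite I"
    and p[measurable]: "\<And>i. i \<in> I \<Longrightarrow> p i \<in> borel_measurable borel" and p0: "\<And>i x. p i x \<ge> 0"
    and T[measurable]: "\<And>i. i \<in> I \<Longrightarrow> T i \<in> borel_measurable borel"
    and c: "\<And>i x. i \<in> I \<Longrightarrow> norm (T i x - x) \<le> c i"
    and p_fin: "\<And>i. i \<in> I \<Longrightarrow> (\<integral>\<^sup>+x. ennreal (p i x) \<partial>lborel) < \<infinity>"
    and P: "P = density lborel (\<lambda>x. ennreal (\<Sum>i\<in>I. p i x))"
    and sP': "sets P' = sets borel" and pP': "prob_space P'"
    and P': "\<And>A. A \<in> sets borel \<Longrightarrow>
       emeasure P' A = (\<Sum>i\<in>I. \<integral>\<^sup>+x. ennreal (p i x) * indicator A (T i x) \<partial>lborel)"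
  shows "wasserstein1 P' Q \<le> wasserstein1 P Q + (\<Sum>i\<in>I. ennreal (c i) * (\<integral>\<^sup>+x. ennreal (p i x) \<partial>lborel))"
proof -
  define C where "C = (\<Sum>i\<in>I. ennreal (c i) * (\<integral>\<^sup>+x. ennreal (p i x) \<partial>lborel))"
  define S where "S x = (\<Sum>i\<in>I. p i x)" for x
  define w where "w i x = p i x / S x" for i x
  have S0: "S x \<ge> 0" for x unfolding S_def by (intro sum_nonneg p0)
  have w0: "w i x \<ge> 0" for i x unfolding w_def by (intro divide_nonneg_nonneg p0 S0)
  have Sm[measurable]: "S \<in> borel_measurable borel" unfolding S_def by measurable
  have wm[measurable]: "i \<in> I \<Longrightarrow> w i \<in> borel_measurable borel" for i unfolding w_def by measurable
  have wS: "w i x * S x = p i x" if "i \<in> I" for i x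
  proof (cases "S x = 0")
    case True
    then have "p i x = 0"
      using that I p0 by (simp add: S_def sum_nonneg_eq_0_iff)
    then show ?thesis by (simp add: w_def)
  qed (simp add: w_def)
  have cost: "wasserstein1 P' Q \<le> (\<integral>\<^sup>+z. ennreal (norm (fst z - snd z)) \<partial>\<pi>) + C" if \<pi>: "\<pi> \<in> couplings P Q" for \<pi>
  proof -
    have s\<pi>[measurable_cong]: "sets \<pi> = sets (borel \<Otimes>\<^sub>M borel)"
      using \<pi> by (simp add: couplings_def)
    interpret \<pi>: prob_space \<pi> using \<pi> by (simp add: couplings_def)
    have fst_int: "(\<integral>\<^sup>+z. ennreal (w i (fst z)) * f (fst z) \<partial>\<pi>) = (\<integral>\<^sup>+x. ennreal (p i x) * f x \<partial>lborel)"
      if [measurable]: "f \<in> borel_measurable borel" and i[measurable]: "i \<in> I" for i and f :: "'a \<Rightarrow> ennreal"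
    proof -
      have "(\<integral>\<^sup>+z. ennreal (w i (fst z)) * f (fst z) \<partial>\<pi>) = (\<integral>\<^sup>+x. ennreal (w i x) * f x \<partial>P)"
        by (rule coupling_nn_integral_marginals[OF \<pi>]) (use i in measurable)
      also have "\<dots> = (\<integral>\<^sup>+x. ennreal (S x) * (ennreal (w i x) * f x) \<partial>lborel)"
        unfolding P S_def[symmetric] by (subst nn_integral_density) (use i in measurable)
      also have "\<dots> = (\<integral>\<^sup>+x. ennreal (p i x) * f x \<partial>lborel)"
        by (intro nn_integral_cong)
           (simp add: wS[OF i, symmetric] ennreal_mult w0 S0 ac_simps)
      finally show ?thesis .
    qed
    \<comment> \<open>Where S vanishes the weights are all 0, by the convention for division by 0, rather than a
       probability vector; P does not charge this set.\<close>
    have w1: "AE z in \<pi>. (\<Sum>i\<in>I. ennreal (w i (fst z))) = 1"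
    proof -
      have "AE x in P. S x \<noteq> 0"
        unfolding P S_def[symmetric] by (subst AE_density) (auto simp: S0)
      moreover have "P = distr \<pi> borel fst" using \<pi> by (simp add: couplings_def)
      ultimately have "AE z in \<pi>. S (fst z) \<noteq> 0"
        by (intro AE_distrD[of fst \<pi> borel]) auto
      then show ?thesis
      proof eventually_elim
        case (elim z)
        have "(\<Sum>i\<in>I. ennreal (w i (fst z))) = ennreal (\<Sum>i\<in>I. w i (fst z))"
          by (simp add: sum_ennreal w0)
        also have "(\<Sum>i\<in>I. w i (fst z)) = 1"
          using elim by (simp add: w_def S_def flip: sum_divide_distrib)
        finally show ?case by simp
      qed
    qed
    \<comment> \<open>The joint law of the label i and the pair (x, y).\<close>
    define \<nu> where "\<nu> = density (count_space I \<Otimes>\<^sub>M \<pi>) (\<lambda>(i, z). ennreal (w i (fst z)))"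
    have meas: "f \<in> borel_measurable (count_space I \<Otimes>\<^sub>M \<pi>)"
      if "\<And>i. i \<in> I \<Longrightarrow> (\<lambda>z. f (i, z)) \<in> borel_measurable \<pi>" for f :: "'i \<times> 'a \<times> 'a \<Rightarrow> 'c::topological_space"
      by (rule measurable_pair_measure_countable1) (use I that in \<open>auto intro: countable_finite\<close>)
    have s\<nu>: "sets \<nu> = sets (count_space I \<Otimes>\<^sub>M \<pi>)" by (simp add: \<nu>_def)
    have int_\<nu>: "(\<integral>\<^sup>+v. f v \<partial>\<nu>) = (\<Sum>i\<in>I. \<integral>\<^sup>+z. ennreal (w i (fst z)) * f (i, z) \<partial>\<pi>)"
      if f: "\<And>i. i \<in> I \<Longrightarrow> (\<lambda>z. f (i, z)) \<in> borel_measurable \<pi>" for f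
    proof -
      have m: "(\<lambda>(i, z). ennreal (w i (fst z))) \<in> borel_measurable (count_space I \<Otimes>\<^sub>M \<pi>)"
        by (rule meas) auto
      have "(\<integral>\<^sup>+v. f v \<partial>\<nu>) = (\<integral>\<^sup>+v. (case v of (i, z) \<Rightarrow> ennreal (w i (fst z))) * f v \<partial>(count_space I \<Otimes>\<^sub>M \<pi>))"
        unfolding \<nu>_def by (rule nn_integral_density[OF m meas[OF f]])
      also have "\<dots> = (\<integral>\<^sup>+i. \<integral>\<^sup>+z. ennreal (w i (fst z)) * f (i, z) \<partial>\<pi> \<partial>count_space I)"
        by (subst \<pi>.nn_integral_fst[symmetric]) (auto intro!: borel_measurable_times_ennreal m meas[OF f])
      also have "\<dots> = (\<Sum>i\<in>I. \<integral>\<^sup>+z. ennreal (w i (fst z)) * f (i, z) \<partial>\<pi>)"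
        using I by (simp add: nn_integral_count_space_finite)
      finally show ?thesis .
    qed
    define X where "X = (\<lambda>(i, z :: 'a \<times> 'a). T i (fst z))"
    define Y where "Y = (\<lambda>(i :: 'i, z :: 'a \<times> 'a). snd z)"
    have Xm: "X \<in> borel_measurable \<nu>" and Ym: "Y \<in> borel_measurable \<nu>"
      unfolding measurable_cong_sets[OF s\<nu> refl] X_def Y_def by (auto intro!: meas)
    have em: "emeasure (distr \<nu> borel Z) A = (\<Sum>i\<in>I. \<integral>\<^sup>+z. ennreal (w i (fst z)) * indicator A (Z (i, z)) \<partial>\<pi>)"
      if Z: "Z \<in> borel_measurable \<nu>" and A[measurable]: "A \<in> sets borel"
        and Z': "\<And>i. i \<in> I \<Longrightarrow> (\<lambda>z. Z (i, z)) \<in> borel_measurable \<pi>" for Z :: "'i \<times> 'a \<times> 'a \<Rightarrow> 'a" and A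
    proof -
      have "emeasure (distr \<nu> borel Z) A = (\<integral>\<^sup>+x. indicator A x \<partial>distr \<nu> borel Z)"
        using A by simp
      also have "\<dots> = (\<integral>\<^sup>+v. indicator A (Z v) \<partial>\<nu>)"
        by (rule nn_integral_distr[OF Z]) measurable
      also have "\<dots> = (\<Sum>i\<in>I. \<integral>\<^sup>+z. ennreal (w i (fst z)) * indicator A (Z (i, z)) \<partial>\<pi>)"
        by (rule int_\<nu>) (intro measurable_compose[OF Z' borel_measurable_indicator] A)
      finally show ?thesis .
    qed
    have "distr \<nu> borel X = P'"
    proof (rule measure_eqI)
      show "sets (distr \<nu> borel X) = sets P'" by (simp add: sP')
      fix A assume "A \<in> sets (distr \<nu> borel X)"
      then have A[measurable]: "A \<in> sets borel" by simp
      show "emeasure (distr \<nu> borel X) A = emeasure P' A"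
        unfolding em[OF Xm A] P'[OF A] by (subst em[OF Xm A]) (auto simp: X_def intro!: sum.cong fst_int)
    qed
    moreover have "distr \<nu> borel Y = Q"
    proof (rule measure_eqI)
      have Q: "Q = distr \<pi> borel snd" using \<pi> by (simp add: couplings_def)
      then show "sets (distr \<nu> borel Y) = sets Q" by simp
      fix A assume "A \<in> sets (distr \<nu> borel Y)"
      then have A[measurable]: "A \<in> sets borel" by simp
      have "emeasure (distr \<nu> borel Y) A = (\<Sum>i\<in>I. \<integral>\<^sup>+z. ennreal (w i (fst z)) * indicator A (snd z) \<partial>\<pi>)"
        by (subst em[OF Ym A]) (auto simp: Y_def)
      also have "\<dots> = (\<integral>\<^sup>+z. (\<Sum>i\<in>I. ennreal (w i (fst z)) * indicator A (snd z)) \<partial>\<pi>)"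
        by (rule nn_integral_sum[symmetric]) measurable
      also have "\<dots> = (\<integral>\<^sup>+z. indicator A (snd z) \<partial>\<pi>)"
        by (rule nn_integral_cong_AE, use w1 in eventually_elim) (simp flip: sum_distrib_right)
      also have "\<dots> = emeasure Q A"
        unfolding coupling_nn_integral_marginals(2)[OF \<pi> borel_measurable_indicator[OF A]] using A by (simp add: Q)
      finally show "emeasure (distr \<nu> borel Y) A = emeasure Q A" .
    qed
    ultimately have "wasserstein1 P' Q \<le> (\<integral>\<^sup>+v. ennreal (norm (X v - Y v)) \<partial>\<nu>)"
      by (intro wasserstein1_le_realisation[OF Xm Ym] pP')
    also have "\<dots> = (\<Sum>i\<in>I. \<integral>\<^sup>+z. ennreal (w i (fst z)) * ennreal (norm (T i (fst z) - snd z)) \<partial>\<pi>)"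
      by (subst int_\<nu>) (auto simp: X_def Y_def)
    also have "\<dots> \<le> (\<Sum>i\<in>I. (\<integral>\<^sup>+z. ennreal (w i (fst z)) * ennreal (norm (fst z - snd z)) \<partial>\<pi>)
                     + ennreal (c i) * (\<integral>\<^sup>+x. ennreal (p i x) \<partial>lborel))"
    proof (rule sum_mono)
      fix i assume i: "i \<in> I"
      have ci: "c i \<ge> 0" using c[OF i, of 0] norm_ge_zero[of "T i 0 - 0"] by linarith
      have tri: "norm (T i x - y) \<le> norm (x - y) + c i" for x y
        using c[OF i, of x] norm_triangle_ineq[of "T i x - x" "x - y"] by simp
      have "(\<integral>\<^sup>+z. ennreal (w i (fst z)) * ennreal (norm (T i (fst z) - snd z)) \<partial>\<pi>)
         \<le> (\<integral>\<^sup>+z. ennreal (w i (fst z)) * ennreal (norm (fst z - snd z)) + ennreal (w i (fst z)) * ennreal (c i) \<partial>\<pi>)"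
        by (intro nn_integral_mono) (auto simp: ci tri simp flip: distrib_left ennreal_plus intro!: mult_left_mono ennreal_leI)
      also have "\<dots> = (\<integral>\<^sup>+z. ennreal (w i (fst z)) * ennreal (norm (fst z - snd z)) \<partial>\<pi>)
           + (\<integral>\<^sup>+z. ennreal (w i (fst z)) * ennreal (c i) \<partial>\<pi>)"
        by (rule nn_integral_add) (use i in measurable)
      also have "(\<integral>\<^sup>+z. ennreal (w i (fst z)) * ennreal (c i) \<partial>\<pi>) = ennreal (c i) * (\<integral>\<^sup>+x. ennreal (p i x) \<partial>lborel)"
        using fst_int[OF borel_measurable_const i, of "ennreal (c i)"] i
        by (simp add: nn_integral_multc) (simp add: mult.commute)
      finally show "(\<integral>\<^sup>+z. ennreal (w i (fst z)) * ennreal (norm (T i (fst z) - snd z)) \<partial>\<pi>)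
         \<le> (\<integral>\<^sup>+z. ennreal (w i (fst z)) * ennreal (norm (fst z - snd z)) \<partial>\<pi>)
           + ennreal (c i) * (\<integral>\<^sup>+x. ennreal (p i x) \<partial>lborel)" .
    qed
    also have "\<dots> = (\<Sum>i\<in>I. (\<integral>\<^sup>+z. ennreal (w i (fst z)) * ennreal (norm (fst z - snd z)) \<partial>\<pi>)) + C"
      by (simp add: sum.distrib C_def)
    also have "(\<Sum>i\<in>I. (\<integral>\<^sup>+z. ennreal (w i (fst z)) * ennreal (norm (fst z - snd z)) \<partial>\<pi>))
       = (\<integral>\<^sup>+z. (\<Sum>i\<in>I. ennreal (w i (fst z)) * ennreal (norm (fst z - snd z))) \<partial>\<pi>)"
      by (rule nn_integral_sum[symmetric]) measurable
    also have "\<dots> = (\<integral>\<^sup>+z. ennreal (norm (fst z - snd z)) \<partial>\<pi>)"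
      by (rule nn_integral_cong_AE, use w1 in eventually_elim) (simp flip: sum_distrib_right)
    finally show ?thesis .
  qed
  have C_fin: "C < \<infinity>"
    unfolding C_def using I p_fin by (auto simp: ennreal_mult_less_top)
  have "wasserstein1 P' Q - C \<le> wasserstein1 P Q"
    unfolding wasserstein1_def[of P Q]
    by (rule INF_greatest, subst ennreal_minus_le_iff) (use cost C_fin in \<open>auto simp: add.commute\<close>)
  then show ?thesis
    using C_fin unfolding C_def[symmetric] by (subst (asm) ennreal_minus_le_iff) (auto simp: add.commute)
qed

text \<open>
  The common part r = min p q stays in place; the excess a of p and the deficit b, both of mass m,
  are coupled independently. Moving from x to y costs at most norm x + norm y, and a + b is the
  absolute difference of the densities.
\<close>

lemma wasserstein1_le_weighted_l1:
  fixes p q :: "'a::euclidean_space \<Rightarrow> real"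
  assumes p[measurable]: "p \<in> borel_measurable borel" and q[measurable]: "q \<in> borel_measurable borel"
    and p0: "\<And>x. p x \<ge> 0" and q0: "\<And>x. q x \<ge> 0"
    and P: "prob_space (density lborel (\<lambda>x. ennreal (p x)))"
    and Q: "prob_space (density lborel (\<lambda>x. ennreal (q x)))"
  shows "wasserstein1 (density lborel (\<lambda>x. ennreal (p x))) (density lborel (\<lambda>x. ennreal (q x)))
           \<le> (\<integral>\<^sup>+x. ennreal (norm x * \<bar>p x - q x\<bar>) \<partial>lborel)"
proof -
  define r where "r x = min (p x) (q x)" for x
  define a where "a x = p x - r x" for x
  define b where "b x = q x - r x" for x
  have [measurable]: "r \<in> borel_measurable borel" "a \<in> borel_measurable borel" "b \<in> borel_measurable borel"
    unfolding r_def a_def b_def by measurable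
  have nn: "r x \<ge> 0" "a x \<ge> 0" "b x \<ge> 0" for x
    using p0[of x] q0[of x] by (auto simp: r_def a_def b_def)
  have ip: "(\<integral>\<^sup>+x. ennreal (p x) \<partial>lborel) = 1"
    using prob_space.emeasure_space_1[OF P] by (simp add: emeasure_density)
  have iq: "(\<integral>\<^sup>+x. ennreal (q x) \<partial>lborel) = 1"
    using prob_space.emeasure_space_1[OF Q] by (simp add: emeasure_density)
  have pr: "ennreal (r x) + ennreal (a x) = ennreal (p x)" "ennreal (r x) + ennreal (b x) = ennreal (q x)" for x
    using nn[of x] by (simp_all add: a_def b_def flip: ennreal_plus)
  have ra: "(\<integral>\<^sup>+x. ennreal (r x) \<partial>lborel) + (\<integral>\<^sup>+x. ennreal (a x) \<partial>lborel) = 1"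
    by (subst nn_integral_add[symmetric]) (auto simp: pr ip)
  have rb: "(\<integral>\<^sup>+x. ennreal (r x) \<partial>lborel) + (\<integral>\<^sup>+x. ennreal (b x) \<partial>lborel) = 1"
    by (subst nn_integral_add[symmetric]) (auto simp: pr iq)
  have le1: "(\<integral>\<^sup>+x. ennreal (r x) \<partial>lborel) \<le> 1" "(\<integral>\<^sup>+x. ennreal (a x) \<partial>lborel) \<le> 1"
    unfolding ra[symmetric] by (auto intro: add_increasing add_increasing2)
  define m where "m = enn2real (\<integral>\<^sup>+x. ennreal (a x) \<partial>lborel)"
  have ia: "(\<integral>\<^sup>+x. ennreal (a x) \<partial>lborel) = ennreal m"
    unfolding m_def using le_less_trans[OF le1(2) ennreal_one_less_top] by (simp add: ennreal_enn2real)
  have "(\<integral>\<^sup>+x. ennreal (r x) \<partial>lborel) \<noteq> \<top>"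
    using le1(1) by (auto simp: top_unique)
  moreover have "(\<integral>\<^sup>+x. ennreal (r x) \<partial>lborel) + (\<integral>\<^sup>+x. ennreal (b x) \<partial>lborel)
      = (\<integral>\<^sup>+x. ennreal (r x) \<partial>lborel) + (\<integral>\<^sup>+x. ennreal (a x) \<partial>lborel)"
    unfolding ra rb ..
  ultimately have ib: "(\<integral>\<^sup>+x. ennreal (b x) \<partial>lborel) = ennreal m"
    unfolding ia[symmetric] ennreal_add_left_cancel infinity_ennreal_def by blast
  have m0: "m \<ge> 0" by (simp add: m_def)
  have am: "AE x in lborel. m = 0 \<longrightarrow> a x = 0 \<and> b x = 0"
  proof (cases "m = 0")
    case True
    have "AE x in lborel. ennreal (a x) = 0"
      by (subst nn_integral_0_iff_AE[symmetric]) (simp_all add: ia True)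
    moreover have "AE x in lborel. ennreal (b x) = 0"
      by (subst nn_integral_0_iff_AE[symmetric]) (simp_all add: ib True)
    ultimately show ?thesis
    proof eventually_elim
      case (elim x)
      then show ?case using nn(2,3)[of x] by (simp add: ennreal_eq_0_iff)
    qed
  qed simp

  \<comment> \<open>The label k says whether the mass stays. On that half only x matters, and y carries the dummy
     probability density p, so that a single density describes both halves. If m = 0, the second half
     is 0, which agrees with a and b vanishing almost everywhere.\<close>
  define D where "D = (\<lambda>(k, x, y). if k then r x * p y else a x * b y / m)"
  define N where "N = count_space (UNIV :: bool set) \<Otimes>\<^sub>M ((lborel :: 'a measure) \<Otimes>\<^sub>M (lborel :: 'a measure))"
  define \<nu> where "\<nu> = density N (\<lambda>v. ennreal (D v))"
  have meas: "f \<in> borel_measurable N"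
    if "\<And>k. (\<lambda>z. f (k, z)) \<in> borel_measurable (lborel \<Otimes>\<^sub>M lborel)" for f :: "bool \<times> 'a \<times> 'a \<Rightarrow> 'c::topological_space"
    unfolding N_def by (rule measurable_pair_measure_countable1) (use that in auto)
  have Dm: "D \<in> borel_measurable N"
    by (rule meas, case_tac k) (auto simp: D_def)
  have s\<nu>: "sets \<nu> = sets N" by (simp add: \<nu>_def)
  have int_\<nu>: "(\<integral>\<^sup>+v. f v \<partial>\<nu>) = (\<integral>\<^sup>+x. \<integral>\<^sup>+y. ennreal (r x * p y) * f (True, x, y) \<partial>lborel \<partial>lborel)
      + (\<integral>\<^sup>+x. \<integral>\<^sup>+y. ennreal (a x * b y / m) * f (False, x, y) \<partial>lborel \<partial>lborel)"
    if f: "\<And>k. (\<lambda>z. f (k, z)) \<in> borel_measurable (lborel \<Otimes>\<^sub>M lborel)" for f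
  proof -
    have fm: "(\<lambda>v. ennreal (D v) * f v) \<in> borel_measurable N"
      by (intro borel_measurable_times_ennreal meas[OF f] measurable_compose[OF Dm]) auto
    note [measurable] = f
    have "(\<integral>\<^sup>+v. f v \<partial>\<nu>) = (\<integral>\<^sup>+v. ennreal (D v) * f v \<partial>N)"
      unfolding \<nu>_def by (rule nn_integral_density) (use Dm meas[OF f] in auto)
    also have "\<dots> = (\<integral>\<^sup>+k. \<integral>\<^sup>+z. ennreal (D (k, z)) * f (k, z) \<partial>(lborel \<Otimes>\<^sub>M lborel) \<partial>count_space UNIV)"
      using fm unfolding N_def
      by (intro sigma_finite_measure.nn_integral_fst[symmetric]) (simp_all add: lborel_prod sigma_finite_lborel)
    also have "\<dots> = (\<integral>\<^sup>+z. ennreal (D (True, z)) * f (True, z) \<partial>(lborel \<Otimes>\<^sub>M lborel))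
       + (\<integral>\<^sup>+z. ennreal (D (False, z)) * f (False, z) \<partial>(lborel \<Otimes>\<^sub>M lborel))"
      by (simp add: nn_integral_count_space_finite UNIV_bool add.commute)
    also have "(\<integral>\<^sup>+z. ennreal (D (True, z)) * f (True, z) \<partial>(lborel \<Otimes>\<^sub>M lborel))
        = (\<integral>\<^sup>+x. \<integral>\<^sup>+y. ennreal (r x * p y) * f (True, x, y) \<partial>lborel \<partial>lborel)"
      by (subst lborel.nn_integral_fst[symmetric]) (auto simp: D_def case_prod_unfold)
    also have "(\<integral>\<^sup>+z. ennreal (D (False, z)) * f (False, z) \<partial>(lborel \<Otimes>\<^sub>M lborel))
        = (\<integral>\<^sup>+x. \<integral>\<^sup>+y. ennreal (a x * b y / m) * f (False, x, y) \<partial>lborel \<partial>lborel)"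
      by (subst lborel.nn_integral_fst[symmetric]) (auto simp: D_def case_prod_unfold)
    finally show ?thesis .
  qed
  have diag: "(\<integral>\<^sup>+x. \<integral>\<^sup>+y. ennreal (r x * p y) * h x \<partial>lborel \<partial>lborel) = (\<integral>\<^sup>+x. ennreal (r x) * h x \<partial>lborel)"
    if [measurable]: "h \<in> borel_measurable borel" for h
  proof (intro nn_integral_cong)
    fix x
    have "(\<integral>\<^sup>+y. ennreal (r x * p y) * h x \<partial>lborel) = (\<integral>\<^sup>+y. (ennreal (r x) * h x) * ennreal (p y) \<partial>lborel)"
      by (intro nn_integral_cong) (simp add: ennreal_mult nn p0 ac_simps)
    also have "\<dots> = ennreal (r x) * h x"
      by (subst nn_integral_cmult) (auto simp: ip)
    finally show "(\<integral>\<^sup>+y. ennreal (r x * p y) * h x \<partial>lborel) = ennreal (r x) * h x" .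
  qed
  have off1: "(\<integral>\<^sup>+x. \<integral>\<^sup>+y. ennreal (a x * b y / m) * h x \<partial>lborel \<partial>lborel) = (\<integral>\<^sup>+x. ennreal (a x) * h x \<partial>lborel)"
    if [measurable]: "h \<in> borel_measurable borel" for h
  proof (intro nn_integral_cong_AE, use am in eventually_elim)
    case (elim x)
    have "(\<integral>\<^sup>+y. ennreal (a x * b y / m) * h x \<partial>lborel) = (\<integral>\<^sup>+y. (ennreal (a x / m) * h x) * ennreal (b y) \<partial>lborel)"
      by (intro nn_integral_cong) (simp add: nn m0 ac_simps flip: ennreal_mult ennreal_mult')
    also have "\<dots> = ennreal (a x / m) * h x * ennreal m"
      by (subst nn_integral_cmult) (auto simp: ib)
    also have "\<dots> = (ennreal (a x / m) * ennreal m) * h x"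
      by (simp only: ac_simps)
    also have "ennreal (a x / m) * ennreal m = ennreal (a x)"
      using elim by (auto simp: nn m0 simp flip: ennreal_mult)
    finally show ?case .
  qed
  have off2: "(\<integral>\<^sup>+x. \<integral>\<^sup>+y. ennreal (a x * b y / m) * h y \<partial>lborel \<partial>lborel) = (\<integral>\<^sup>+y. ennreal (b y) * h y \<partial>lborel)"
    if [measurable]: "h \<in> borel_measurable borel" for h
  proof -
    have "(\<integral>\<^sup>+x. \<integral>\<^sup>+y. ennreal (a x * b y / m) * h y \<partial>lborel \<partial>lborel)
        = (\<integral>\<^sup>+y. \<integral>\<^sup>+x. ennreal (a x * b y / m) * h y \<partial>lborel \<partial>lborel)"
      by (rule lborel_pair.Fubini') measurable
    also have "\<dots> = (\<integral>\<^sup>+y. ennreal (b y) * h y \<partial>lborel)"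
    proof (intro nn_integral_cong_AE, use am in eventually_elim)
      case (elim y)
      have "(\<integral>\<^sup>+x. ennreal (a x * b y / m) * h y \<partial>lborel) = (\<integral>\<^sup>+x. (ennreal (b y / m) * h y) * ennreal (a x) \<partial>lborel)"
        by (intro nn_integral_cong) (simp add: nn m0 ac_simps flip: ennreal_mult ennreal_mult')
      also have "\<dots> = ennreal (b y / m) * h y * ennreal m"
        by (subst nn_integral_cmult) (auto simp: ia)
      also have "\<dots> = (ennreal (b y / m) * ennreal m) * h y"
        by (simp only: ac_simps)
      also have "ennreal (b y / m) * ennreal m = ennreal (b y)"
        using elim by (auto simp: nn m0 simp flip: ennreal_mult)
      finally show ?case .
    qed
    finally show ?thesis .
  qed
  define X where "X = (\<lambda>(k :: bool, x :: 'a, y :: 'a). x)"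
  define Y where "Y = (\<lambda>(k, x :: 'a, y :: 'a). if k then x else y)"
  have X': "(\<lambda>z. X (k, z)) \<in> borel_measurable (lborel \<Otimes>\<^sub>M lborel)" for k
    by (auto simp: X_def case_prod_unfold)
  have Y': "(\<lambda>z. Y (k, z)) \<in> borel_measurable (lborel \<Otimes>\<^sub>M lborel)" for k
    by (cases k) (auto simp: Y_def case_prod_unfold)
  have Xm: "X \<in> borel_measurable \<nu>" and Ym: "Y \<in> borel_measurable \<nu>"
    unfolding measurable_cong_sets[OF s\<nu> refl] by (intro meas X' Y')+
  have em: "emeasure (distr \<nu> borel Z) A = (\<integral>\<^sup>+v. indicator A (Z v) \<partial>\<nu>)"
    if Z: "Z \<in> borel_measurable \<nu>" and A[measurable]: "A \<in> sets borel" for Z :: "bool \<times> 'a \<times> 'a \<Rightarrow> 'a" and A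
  proof -
    have "emeasure (distr \<nu> borel Z) A = (\<integral>\<^sup>+x. indicator A x \<partial>distr \<nu> borel Z)"
      using A by simp
    also have "\<dots> = (\<integral>\<^sup>+v. indicator A (Z v) \<partial>\<nu>)"
      by (rule nn_integral_distr[OF Z]) measurable
    finally show ?thesis .
  qed
  have dX: "distr \<nu> borel X = density lborel (\<lambda>x. ennreal (p x))"
  proof (rule measure_eqI)
    fix A assume "A \<in> sets (distr \<nu> borel X)"
    then have A[measurable]: "A \<in> sets borel" by simp
    have "emeasure (distr \<nu> borel X) A
      = (\<integral>\<^sup>+x. ennreal (r x) * indicator A x \<partial>lborel) + (\<integral>\<^sup>+x. ennreal (a x) * indicator A x \<partial>lborel)"
      unfolding em[OF Xm A]
      by (subst int_\<nu>) (auto simp: X_def diag off1 case_prod_unfold)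
    also have "\<dots> = (\<integral>\<^sup>+x. ennreal (p x) * indicator A x \<partial>lborel)"
      by (subst nn_integral_add[symmetric]) (auto simp: pr simp flip: distrib_right)
    also have "\<dots> = emeasure (density lborel (\<lambda>x. ennreal (p x))) A"
      by (rule emeasure_density[symmetric]) auto
    finally show "emeasure (distr \<nu> borel X) A = emeasure (density lborel (\<lambda>x. ennreal (p x))) A" .
  qed simp
  have dY: "distr \<nu> borel Y = density lborel (\<lambda>x. ennreal (q x))"
  proof (rule measure_eqI)
    fix A assume "A \<in> sets (distr \<nu> borel Y)"
    then have A[measurable]: "A \<in> sets borel" by simp
    have "emeasure (distr \<nu> borel Y) A
      = (\<integral>\<^sup>+x. ennreal (r x) * indicator A x \<partial>lborel) + (\<integral>\<^sup>+x. ennreal (b x) * indicator A x \<partial>lborel)"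
      unfolding em[OF Ym A]
      by (subst int_\<nu>, rule measurable_compose[OF Y']) (auto simp: Y_def diag off2 case_prod_unfold)
    also have "\<dots> = (\<integral>\<^sup>+x. ennreal (q x) * indicator A x \<partial>lborel)"
      by (subst nn_integral_add[symmetric]) (auto simp: pr simp flip: distrib_right)
    also have "\<dots> = emeasure (density lborel (\<lambda>x. ennreal (q x))) A"
      by (rule emeasure_density[symmetric]) auto
    finally show "emeasure (distr \<nu> borel Y) A = emeasure (density lborel (\<lambda>x. ennreal (q x))) A" .
  qed simp
  have "wasserstein1 (density lborel (\<lambda>x. ennreal (p x))) (density lborel (\<lambda>x. ennreal (q x)))
      \<le> (\<integral>\<^sup>+v. ennreal (norm (X v - Y v)) \<partial>\<nu>)"
    by (rule wasserstein1_le_realisation[OF Xm Ym dX dY P])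
  also have "\<dots> \<le> (\<integral>\<^sup>+v. (if fst v then 0 else ennreal (norm (X v)) + ennreal (norm (Y v))) \<partial>\<nu>)"
    by (intro nn_integral_mono)
       (auto simp: X_def Y_def norm_triangle_ineq4 simp flip: ennreal_plus intro!: ennreal_leI)
  also have "\<dots> = (\<integral>\<^sup>+x. \<integral>\<^sup>+y. ennreal (a x * b y / m) * (ennreal (norm x) + ennreal (norm y)) \<partial>lborel \<partial>lborel)"
    by (subst int_\<nu>, case_tac k) (auto simp: X_def Y_def case_prod_unfold)
  also have "\<dots> = (\<integral>\<^sup>+x. (\<integral>\<^sup>+y. ennreal (a x * b y / m) * ennreal (norm x) \<partial>lborel)
        + (\<integral>\<^sup>+y. ennreal (a x * b y / m) * ennreal (norm y) \<partial>lborel) \<partial>lborel)"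
    unfolding distrib_left by (intro nn_integral_cong nn_integral_add) measurable
  also have "\<dots> = (\<integral>\<^sup>+x. ennreal (a x) * ennreal (norm x) \<partial>lborel) + (\<integral>\<^sup>+y. ennreal (b y) * ennreal (norm y) \<partial>lborel)"
    by (subst nn_integral_add) (simp_all add: off1 off2)
  also have "\<dots> = (\<integral>\<^sup>+x. ennreal (norm x * \<bar>p x - q x\<bar>) \<partial>lborel)"
  proof (subst nn_integral_add[symmetric])
    have "\<bar>p x - q x\<bar> = a x + b x" for x
      by (auto simp: a_def b_def r_def)
    then show "(\<integral>\<^sup>+x. ennreal (a x) * ennreal (norm x) + ennreal (b x) * ennreal (norm x) \<partial>lborel)
        = (\<integral>\<^sup>+x. ennreal (norm x * \<bar>p x - q x\<bar>) \<partial>lborel)"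
      by (intro nn_integral_cong) (simp add: nn ac_simps distrib_left flip: ennreal_mult ennreal_plus)
  qed auto
  finally show ?thesis .
qed

section \<open>Translations, finiteness and empirical measures\<close>

lemma nn_integral_lborel_translate:
  fixes f :: "'a::euclidean_space \<Rightarrow> ennreal"
  assumes [measurable]: "f \<in> borel_measurable borel"
  shows "(\<integral>\<^sup>+z. f (c + z) \<partial>lborel) = (\<integral>\<^sup>+z. f z \<partial>lborel)"
proof -
  have "(\<integral>\<^sup>+z. f z \<partial>lborel) = (\<integral>\<^sup>+z. f z \<partial>distr lborel borel ((+) c))"
    by (simp add: lborel_distr_plus)
  also have "\<dots> = (\<integral>\<^sup>+z. f (c + z) \<partial>lborel)"
    by (rule nn_integral_distr) auto
  finally show ?thesis ..
qed

text \<open>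
  The independent coupling costs at most the sum of the first moments.
\<close>

lemma wasserstein1_finite:
  assumes P: "P \<in> P1" and Q: "Q \<in> P1"
  shows "wasserstein1 P Q < \<infinity>"
proof -
  interpret P: prob_space P using P by (simp add: P1_def)
  interpret Q: prob_space Q using Q by (simp add: P1_def)
  have [measurable_cong]: "sets P = sets borel" "sets Q = sets borel" using P Q by (simp_all add: P1_def)
  interpret PQ: pair_prob_space P Q ..
  have P': "(\<integral>\<^sup>+x. ennreal (norm x) \<partial>P) < \<infinity>" and Q': "(\<integral>\<^sup>+x. ennreal (norm x) \<partial>Q) < \<infinity>"
    using P Q by (auto simp: P1_def integrable_iff_bounded)
  have d: "distr (P \<Otimes>\<^sub>M Q) borel fst = P" "distr (P \<Otimes>\<^sub>M Q) borel snd = Q"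
  proof -
    have "distr (P \<Otimes>\<^sub>M Q) borel fst = distr (P \<Otimes>\<^sub>M Q) P fst"
      by (rule distr_cong) (use P in \<open>auto simp: P1_def\<close>)
    then show "distr (P \<Otimes>\<^sub>M Q) borel fst = P" by (simp add: Q.distr_pair_fst)
    have "distr (P \<Otimes>\<^sub>M Q) borel snd = distr (P \<Otimes>\<^sub>M Q) Q snd"
      by (rule distr_cong) (use Q in \<open>auto simp: P1_def\<close>)
    also have "\<dots> = Q"
    proof (rule measure_eqI)
      fix A assume "A \<in> sets (distr (P \<Otimes>\<^sub>M Q) Q snd)"
      then have A: "A \<in> sets Q" by simp
      then have "snd -` A \<inter> space (P \<Otimes>\<^sub>M Q) = space P \<times> A"
        using sets.sets_into_space[OF A] by (auto simp: space_pair_measure)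
      then show "emeasure (distr (P \<Otimes>\<^sub>M Q) Q snd) A = emeasure Q A"
        using A by (simp add: emeasure_distr Q.emeasure_pair_measure_Times P.emeasure_space_1)
    qed simp
    finally show "distr (P \<Otimes>\<^sub>M Q) borel snd = Q" .
  qed
  have "wasserstein1 P Q \<le> (\<integral>\<^sup>+z. ennreal (norm (fst z - snd z)) \<partial>(P \<Otimes>\<^sub>M Q))"
    by (intro wasserstein1_le_realisation d P.prob_space_axioms) measurable
  also have "\<dots> \<le> (\<integral>\<^sup>+z. ennreal (norm (fst z)) + ennreal (norm (snd z)) \<partial>(P \<Otimes>\<^sub>M Q))"
    by (intro nn_integral_mono) (auto simp: norm_triangle_ineq4 simp flip: ennreal_plus intro!: ennreal_leI)
  also have "\<dots> = (\<integral>\<^sup>+z. ennreal (norm (fst z)) \<partial>(P \<Otimes>\<^sub>M Q)) + (\<integral>\<^sup>+z. ennreal (norm (snd z)) \<partial>(P \<Otimes>\<^sub>M Q))"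
    by (rule nn_integral_add) measurable
  also have "\<dots> = (\<integral>\<^sup>+x. ennreal (norm x) \<partial>P) + (\<integral>\<^sup>+x. ennreal (norm x) \<partial>Q)"
    by (subst (1 2) Q.nn_integral_fst[symmetric]) (simp_all add: P.emeasure_space_1 Q.emeasure_space_1)
  also have "\<dots> < \<infinity>" using P' Q' by simp
  finally show ?thesis .
qed

lemma convolution_in_P1:
  fixes M N :: "'a::ordered_euclidean_space measure"
  assumes M: "M \<in> P1" and N: "N \<in> P1"
  shows "convolution M N \<in> P1"
proof -
  interpret M: prob_space M using M by (simp add: P1_def)
  interpret N: prob_space N using N by (simp add: P1_def)
  have [measurable_cong]: "sets M = sets borel" "sets N = sets borel" using M N by (simp_all add: P1_def)
  interpret MN: pair_prob_space M N ..
  have "prob_space (convolution M N)"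
    unfolding convolution_def by (rule MN.prob_space_distr) measurable
  moreover have "integrable (convolution M N) norm"
    unfolding integrable_iff_bounded
  proof
    have "(\<integral>\<^sup>+x. ennreal (norm (norm x)) \<partial>convolution M N) = (\<integral>\<^sup>+x. \<integral>\<^sup>+y. ennreal (norm (x + y)) \<partial>N \<partial>M)"
      by (subst nn_integral_convolution) (use M N in \<open>auto simp: P1_def M.finite_measure_axioms N.finite_measure_axioms\<close>)
    also have "\<dots> \<le> (\<integral>\<^sup>+x. \<integral>\<^sup>+y. ennreal (norm x) + ennreal (norm y) \<partial>N \<partial>M)"
      by (intro nn_integral_mono) (auto simp: norm_triangle_ineq simp flip: ennreal_plus intro!: ennreal_leI)
    also have "\<dots> = (\<integral>\<^sup>+x. ennreal (norm x) \<partial>M) + (\<integral>\<^sup>+y. ennreal (norm y) \<partial>N)"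
      by (simp add: nn_integral_add M.emeasure_space_1 N.emeasure_space_1)
    also have "\<dots> < \<infinity>"
      using M N by (auto simp: P1_def integrable_iff_bounded)
    finally show "(\<integral>\<^sup>+x. ennreal (norm (norm x)) \<partial>convolution M N) < \<infinity>" .
  qed simp
  ultimately show ?thesis by (simp add: P1_def)
qed

lemma sets_empirical_measure [simp, measurable_cong]:
  "sets (empirical_measure n x) = sets (borel :: 'a::topological_space measure)"
  unfolding empirical_measure_def
  using sets.sets_measure_of_eq[of "borel :: 'a measure"] by simp

text \<open>
  As the law of a sample point picked uniformly at random, the empirical measure turns averages over the
  sample into integrals.
\<close>

lemma empirical_measure_eq_distr:
  assumes "n \<ge> 1"
  shows "empirical_measure n x = distr (measure_pmf (pmf_of_set {..<n})) borel x"
proof (rule measure_eqI)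
  show "sets (empirical_measure n x) = sets (distr (measure_pmf (pmf_of_set {..<n})) borel x)"
    by simp
  fix A assume "A \<in> sets (empirical_measure n x)"
  then have A: "A \<in> sets borel" by simp
  have "emeasure (distr (measure_pmf (pmf_of_set {..<n})) borel x) A
      = (\<integral>\<^sup>+i. indicator A (x i) \<partial>measure_pmf (pmf_of_set {..<n}))"
    using A by (subst nn_integral_distr[symmetric, where M' = borel]) auto
  also have "\<dots> = (\<Sum>i<n. indicator A (x i)) / of_nat n"
    using assms by (subst nn_integral_pmf_of_set) (auto simp: lessThan_empty_iff)
  finally show "emeasure (empirical_measure n x) A = emeasure (distr (measure_pmf (pmf_of_set {..<n})) borel x) A"
    using assms A by (simp add: emeasure_empirical_measure)
qed

lemma integral_empirical_measure:
  fixes f :: "'a::topological_space \<Rightarrow> real"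
  assumes "n \<ge> 1" "f \<in> borel_measurable borel"
  shows "(\<integral>u. f u \<partial>empirical_measure n x) = (\<Sum>i<n. f (x i)) / real n"
  using assms
  by (simp add: empirical_measure_eq_distr integral_distr integral_pmf_of_set lessThan_empty_iff)

lemma empirical_measure_in_P1:
  assumes "n \<ge> 1"
  shows "empirical_measure n x \<in> P1"
proof -
  have "prob_space (empirical_measure n x)"
    unfolding empirical_measure_eq_distr[OF assms] by (rule measure_pmf.prob_space_distr) simp
  moreover have "integrable (empirical_measure n x) norm"
    unfolding empirical_measure_eq_distr[OF assms]
    using assms by (subst integrable_distr_eq) (auto intro!: integrable_measure_pmf_finite simp: lessThan_empty_iff)
  ultimately show ?thesis
    by (simp add: P1_def)
qed

section \<open>Smoothing by a bounded density\<close>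

text \<open>
  Boundedness of the density makes all averages of its translates exist, and the finite first moment of
  the smoothing measure makes the smoothed distances finite.
\<close>

locale bounded_smoothing_density =
  fixes \<gamma> :: "'a::ordered_euclidean_space \<Rightarrow> real" and C :: real and G :: "'a measure"
  assumes \<gamma>_measurable[measurable]: "\<gamma> \<in> borel_measurable borel"
    and \<gamma>_nonneg: "\<And>z. \<gamma> z \<ge> 0" and \<gamma>_le: "\<And>z. \<gamma> z \<le> C"
    and G_eq: "G = density lborel (\<lambda>z. ennreal (\<gamma> z))" and G_P1: "G \<in> P1"
begin

definition smoothed :: "'a measure \<Rightarrow> 'a \<Rightarrow> real" where
  "smoothed M z = (\<integral>x. \<gamma> (z - x) \<partial>M)"

lemma smoothed_nonneg: "smoothed M z \<ge> 0"
  unfolding smoothed_def by (rule integral_nonneg_AE) (simp add: \<gamma>_nonneg)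

lemma integrable_\<gamma>:
  assumes "prob_space M" "sets M = sets borel"
  shows "integrable M (\<lambda>x. \<gamma> (z - x))"
proof -
  interpret prob_space M by fact
  note [measurable_cong] = assms(2)
  show ?thesis
    by (rule integrable_const_bound[where B = C]) (auto simp: \<gamma>_nonneg \<gamma>_le)
qed

lemma measurable_smoothed[measurable]:
  assumes "prob_space M" "sets M = sets borel"
  shows "smoothed M \<in> borel_measurable borel"
proof -
  interpret prob_space M by fact
  note [measurable_cong] = assms(2)
  show ?thesis unfolding smoothed_def by measurable
qed

lemma convolution_eq_density:
  assumes M: "prob_space M" and sM: "sets M = sets borel"
  shows "convolution M G = density lborel (\<lambda>z. ennreal (smoothed M z))"
proof (rule measure_eqI)
  interpret M: prob_space M by fact
  interpret pair_sigma_finite M "lborel :: 'a measure" ..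
  note [measurable_cong] = sM
  note sm[measurable] = measurable_smoothed[OF M sM]
  show "sets (convolution M G) = sets (density lborel (\<lambda>z. ennreal (smoothed M z)))" by simp
  fix A assume "A \<in> sets (convolution M G)"
  then have A[measurable]: "A \<in> sets borel" by simp
  have "emeasure (convolution M G) A = (\<integral>\<^sup>+x. \<integral>\<^sup>+y. indicator A (x + y) \<partial>G \<partial>M)"
    by (rule convolution_emeasure')
       (use G_P1 in \<open>auto simp: P1_def sM M.finite_measure_axioms prob_space_def\<close>)
  also have "\<dots> = (\<integral>\<^sup>+x. \<integral>\<^sup>+z. ennreal (\<gamma> (z - x)) * indicator A z \<partial>lborel \<partial>M)"
  proof (intro nn_integral_cong)
    fix x
    have "(\<integral>\<^sup>+y. indicator A (x + y) \<partial>G) = (\<integral>\<^sup>+y. ennreal (\<gamma> ((x + y) - x)) * indicator A (x + y) \<partial>lborel)"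
      unfolding G_eq by (subst nn_integral_density) auto
    also have "\<dots> = (\<integral>\<^sup>+z. ennreal (\<gamma> (z - x)) * indicator A z \<partial>lborel)"
      by (rule nn_integral_lborel_translate[of "\<lambda>z. ennreal (\<gamma> (z - x)) * indicator A z"]) measurable
    finally show "(\<integral>\<^sup>+y. indicator A (x + y) \<partial>G) = (\<integral>\<^sup>+z. ennreal (\<gamma> (z - x)) * indicator A z \<partial>lborel)" .
  qed
  also have "\<dots> = (\<integral>\<^sup>+z. \<integral>\<^sup>+x. ennreal (\<gamma> (z - x)) * indicator A z \<partial>M \<partial>lborel)"
    by (rule Fubini'[symmetric]) measurable
  also have "\<dots> = (\<integral>\<^sup>+z. ennreal (smoothed M z) * indicator A z \<partial>lborel)"
  proof (intro nn_integral_cong)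
    fix z
    have "(\<integral>\<^sup>+x. ennreal (\<gamma> (z - x)) * indicator A z \<partial>M) = (\<integral>\<^sup>+x. ennreal (\<gamma> (z - x)) \<partial>M) * indicator A z"
      by (rule nn_integral_multc) measurable
    also have "(\<integral>\<^sup>+x. ennreal (\<gamma> (z - x)) \<partial>M) = ennreal (smoothed M z)"
      unfolding smoothed_def by (rule nn_integral_eq_integral) (auto simp: integrable_\<gamma>[OF M sM] \<gamma>_nonneg)
    finally show "(\<integral>\<^sup>+x. ennreal (\<gamma> (z - x)) * indicator A z \<partial>M) = ennreal (smoothed M z) * indicator A z" .
  qed
  also have "\<dots> = emeasure (density lborel (\<lambda>z. ennreal (smoothed M z))) A"
    by (rule emeasure_density[symmetric]) auto
  finally show "emeasure (convolution M G) A = emeasure (density lborel (\<lambda>z. ennreal (smoothed M z))) A" .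
qed

lemma smoothed_empirical:
  assumes "n \<ge> 1"
  shows "smoothed (empirical_measure n x) z = (\<Sum>i<n. \<gamma> (z - x i)) / real n"
  unfolding smoothed_def by (rule integral_empirical_measure[OF assms]) measurable

lemma convolution_kernel_in_P1:
  "M \<in> P1 \<Longrightarrow> convolution M G \<in> P1"
  by (rule convolution_in_P1[OF _ G_P1])

lemma nn_integral_\<gamma>_translate: "(\<integral>\<^sup>+z. ennreal (\<gamma> (z - c)) \<partial>lborel) = 1"
proof -
  have "(\<integral>\<^sup>+z. ennreal (\<gamma> (z - c)) \<partial>lborel) = (\<integral>\<^sup>+z. ennreal (\<gamma> z) \<partial>lborel)"
    using nn_integral_lborel_translate[of "\<lambda>z. ennreal (\<gamma> z)" "- c"] by simp
  also have "\<dots> = emeasure G (space G)"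
    by (simp add: G_eq emeasure_density)
  also have "\<dots> = 1"
    using G_P1 by (simp add: P1_def prob_space.emeasure_space_1)
  finally show ?thesis .
qed

text \<open>
  The smoothed empirical measure is the mixture of the translates of the smoothing density to the sample
  points, so moving the points from y to x translates the i-th component, of mass 1/n, by x i - y i.
\<close>

lemma wasserstein1_empirical_perturb:
  assumes n: "n \<ge> 1"
  shows "wasserstein1 (convolution (empirical_measure n x) G) Q
     \<le> wasserstein1 (convolution (empirical_measure n y) G) Q + ennreal ((\<Sum>i<n. norm (x i - y i)) / real n)"
proof -
  have E: "prob_space (empirical_measure n x)" "sets (empirical_measure n x) = sets borel" for x :: "nat \<Rightarrow> 'a"
    using empirical_measure_in_P1[OF n, of x] by (auto simp: P1_def)
  have dens: "convolution (empirical_measure n x) G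
       = density lborel (\<lambda>z. ennreal (\<Sum>i<n. \<gamma> (z - x i) / real n))" for x
    unfolding convolution_eq_density[OF E] smoothed_empirical[OF n] by (simp add: sum_divide_distrib)
  have mass: "(\<integral>\<^sup>+z. ennreal (\<gamma> (z - c) / real n) \<partial>lborel) = ennreal (1 / real n)" for c
  proof -
    have "(\<integral>\<^sup>+z. ennreal (\<gamma> (z - c) / real n) \<partial>lborel) = (\<integral>\<^sup>+z. ennreal (1 / real n) * ennreal (\<gamma> (z - c)) \<partial>lborel)"
      by (intro nn_integral_cong) (simp add: \<gamma>_nonneg flip: ennreal_mult)
    then show ?thesis
      by (simp add: nn_integral_cmult nn_integral_\<gamma>_translate)
  qed
  have "wasserstein1 (convolution (empirical_measure n x) G) Q
     \<le> wasserstein1 (convolution (empirical_measure n y) G) Q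
       + (\<Sum>i<n. ennreal (norm (x i - y i)) * (\<integral>\<^sup>+z. ennreal (\<gamma> (z - y i) / real n) \<partial>lborel))"
  proof (rule wasserstein1_transport_mixture[where T = "\<lambda>i z. (x i - y i) + z", OF _ _ _ _ _ _ dens[of y]])
    show "prob_space (convolution (empirical_measure n x) G)"
      using convolution_kernel_in_P1[OF empirical_measure_in_P1[OF n]] by (simp add: P1_def)
    fix A :: "'a set" assume A[measurable]: "A \<in> sets borel"
    have "emeasure (convolution (empirical_measure n x) G) A
        = (\<integral>\<^sup>+z. (\<Sum>i<n. ennreal (\<gamma> (z - x i) / real n) * indicator A z) \<partial>lborel)"
      unfolding dens by (subst emeasure_density) (auto simp: \<gamma>_nonneg sum_distrib_right simp flip: sum_ennreal)
    also have "\<dots> = (\<Sum>i<n. \<integral>\<^sup>+z. ennreal (\<gamma> (z - x i) / real n) * indicator A z \<partial>lborel)"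
      by (rule nn_integral_sum) measurable
    also have "\<dots> = (\<Sum>i<n. \<integral>\<^sup>+z. ennreal (\<gamma> (z - y i) / real n) * indicator A ((x i - y i) + z) \<partial>lborel)"
    proof (rule sum.cong[OF refl])
      fix i
      show "(\<integral>\<^sup>+z. ennreal (\<gamma> (z - x i) / real n) * indicator A z \<partial>lborel)
          = (\<integral>\<^sup>+z. ennreal (\<gamma> (z - y i) / real n) * indicator A ((x i - y i) + z) \<partial>lborel)"
        using nn_integral_lborel_translate[of "\<lambda>z. ennreal (\<gamma> (z - x i) / real n) * indicator A z" "x i - y i"]
        by (simp add: algebra_simps)
    qed
    finally show "emeasure (convolution (empirical_measure n x) G) A
       = (\<Sum>i<n. \<integral>\<^sup>+z. ennreal (\<gamma> (z - y i) / real n) * indicator A ((x i - y i) + z) \<partial>lborel)" .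
  qed (auto simp: \<gamma>_nonneg mass)
  also have "(\<Sum>i<n. ennreal (norm (x i - y i)) * (\<integral>\<^sup>+z. ennreal (\<gamma> (z - y i) / real n) \<partial>lborel))
     = ennreal ((\<Sum>i<n. norm (x i - y i)) / real n)"
    by (simp add: mass sum_divide_distrib flip: ennreal_mult sum_ennreal)
  finally show ?thesis .
qed

text \<open>
  Finiteness of the distance is what allows the bound to be passed from extended reals to reals.
\<close>

lemma smooth_wasserstein1_lipschitz:
  assumes n: "n \<ge> 1" and \<mu>: "\<mu> \<in> P1"
  shows "\<bar>smooth_wasserstein1 G (empirical_measure n x) \<mu> - smooth_wasserstein1 G (empirical_measure n y) \<mu>\<bar>
     \<le> (\<Sum>i<n. norm (x i - y i)) / real n"
proof -
  have "smooth_wasserstein1 G (empirical_measure n x) \<mu>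
      \<le> smooth_wasserstein1 G (empirical_measure n y) \<mu> + (\<Sum>i<n. norm (x i - y i)) / real n" for x y
  proof -
    have fin: "wasserstein1 (convolution (empirical_measure n y) G) (convolution \<mu> G) < \<top>"
      using wasserstein1_finite[OF convolution_kernel_in_P1 convolution_kernel_in_P1] empirical_measure_in_P1[OF n] \<mu> by auto
    have "smooth_wasserstein1 G (empirical_measure n x) \<mu>
       \<le> enn2real (wasserstein1 (convolution (empirical_measure n y) G) (convolution \<mu> G)
           + ennreal ((\<Sum>i<n. norm (x i - y i)) / real n))"
      unfolding smooth_wasserstein1_def
      by (rule enn2real_mono[OF wasserstein1_empirical_perturb[OF n]]) (use fin in simp)
    also have "\<dots> = smooth_wasserstein1 G (empirical_measure n y) \<mu> + (\<Sum>i<n. norm (x i - y i)) / real n"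
      unfolding smooth_wasserstein1_def using fin by (simp add: enn2real_plus sum_nonneg)
    finally show ?thesis .
  qed
  from this[of x y] this[of y x] show ?thesis
    by (simp add: norm_minus_commute abs_le_iff)
qed

text \<open>
  The distance is an infimum over an uncountable set of couplings, so measurability is not visible
  from its definition. It follows from the Lipschitz bound, which gives continuity in the product topology.
\<close>

lemma smooth_wasserstein1_measurable:
  assumes n: "n \<ge> 1" and \<mu>: "\<mu> \<in> P1"
  shows "(\<lambda>x. smooth_wasserstein1 G (empirical_measure n x) \<mu>) \<in> borel_measurable (PiM {..<n} (\<lambda>_. \<mu>))"
proof -
  have [measurable_cong]: "sets \<mu> = sets borel" using \<mu> by (simp add: P1_def)
  define L where "L x = smooth_wasserstein1 G (empirical_measure n x) \<mu>" for x
  have lip: "\<bar>L x - L y\<bar> \<le> (\<Sum>i<n. norm (x i - y i)) / real n" for x y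
    unfolding L_def by (rule smooth_wasserstein1_lipschitz[OF n \<mu>])
  have "isCont L y" for y
    unfolding isCont_def
  proof (rule Lim_null[THEN iffD2], rule Lim_null_comparison)
    show "\<forall>\<^sub>F x in at y. norm (L x - L y) \<le> (\<Sum>i<n. norm (x i - y i)) / real n"
      using lip by simp
    have "((\<lambda>x. x i) \<longlongrightarrow> y i) (at y)" for i
      using continuous_on_product_coordinates[of i, where 'b = 'a] by (auto simp: continuous_on_def)
    then have "((\<lambda>x. (\<Sum>i<n. norm (x i - y i)) / real n) \<longlongrightarrow> (\<Sum>i<n. norm (y i - y i)) / real n) (at y)"
      using n by (intro tendsto_intros) auto
    then show "((\<lambda>x. (\<Sum>i<n. norm (x i - y i)) / real n) \<longlongrightarrow> 0) (at y)" by simp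
  qed
  then have "L \<in> borel_measurable borel"
    by (intro borel_measurable_continuous_onI continuous_at_imp_continuous_on) auto
  then have Lm: "L \<in> borel_measurable (PiM UNIV (\<lambda>_. borel))"
    by (simp add: measurable_cong_sets[OF sets_PiM_equal_borel refl])
  \<comment> \<open>Continuity is available on all sequences, whose product sigma-algebra is the Borel one, while the
     sample consists of n points only; coordinates beyond n do not influence L.\<close>
  define ext where "ext x i = (if i < n then x i else 0)" for x :: "nat \<Rightarrow> 'a" and i
  have "ext \<in> measurable (PiM {..<n} (\<lambda>_. \<mu>)) (PiM UNIV (\<lambda>_. borel))"
  proof (rule measurable_PiM_single')
    show "(\<lambda>x. ext x i) \<in> borel_measurable (PiM {..<n} (\<lambda>_. \<mu>))" for i
      by (cases "i < n") (auto simp: ext_def)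
  qed auto
  from measurable_compose[OF this Lm]
  have "(\<lambda>x. L (ext x)) \<in> borel_measurable (PiM {..<n} (\<lambda>_. \<mu>))" .
  moreover have "L (ext x) = L x" for x
    using lip[of "ext x" x] by (simp add: ext_def)
  ultimately show ?thesis by (simp add: L_def)
qed

end

section \<open>The support of a measure\<close>

lemma closed_supp: "closed (supp M)"
proof -
  have "- supp M = \<Union>{U. open U \<and> emeasure M U = 0}"
    by (auto simp: supp_def)
  then show ?thesis
    unfolding closed_def by (metis (no_types, lifting) mem_Collect_eq open_Union)
qed

text \<open>
  The complement of the support is a union of open null sets, and by Lindelof's theorem countably many
  of them suffice.
\<close>

lemma AE_in_supp:
  fixes M :: "'a::second_countable_topology measure"
  assumes sM: "sets M = sets borel"
  shows "AE x in M. x \<in> supp M"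
proof -
  define F where "F = {U. open U \<and> emeasure M U = 0}"
  obtain F' where F': "F' \<subseteq> F" "countable F'" "\<Union>F' = \<Union>F"
    using Lindelof[of F] by (auto simp: F_def)
  have "\<Union>F' \<in> null_sets M"
  proof (rule null_sets_UN'[OF F'(2), of "\<lambda>U. U", simplified])
    show "U \<in> null_sets M" if "U \<in> F'" for U
      using that F'(1) sM by (auto simp: F_def null_sets_def)
  qed
  then show ?thesis
    by (rule AE_I') (use F'(3) in \<open>auto simp: supp_def F_def\<close>)
qed

lemma supp_nonempty:
  fixes M :: "'a::second_countable_topology measure"
  assumes "prob_space M" "sets M = sets borel"
  shows "supp M \<noteq> {}"
proof
  assume "supp M = {}"
  then have "AE x in M. False" using AE_in_supp[OF assms(2)] by simp
  then show False using assms(1) prob_space.AE_False by blast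
qed

section \<open>Mean absolute deviation of an average of independent variables\<close>

text \<open>
  The mixed terms vanish because the added coordinate is independent of the others and has mean 0.
\<close>

lemma iid_second_moment:
  fixes \<psi> :: "'a \<Rightarrow> real"
  assumes \<mu>: "prob_space \<mu>" and "finite I" and m[measurable]: "\<psi> \<in> borel_measurable \<mu>"
    and bd: "\<And>x. \<bar>\<psi> x\<bar> \<le> B" and mean: "(\<integral>x. \<psi> x \<partial>\<mu>) = 0"
  shows "(\<integral>x. (\<Sum>i\<in>I. \<psi> (x i))\<^sup>2 \<partial>PiM I (\<lambda>_. \<mu>)) = real (card I) * (\<integral>x. (\<psi> x)\<^sup>2 \<partial>\<mu>)"
  using \<open>finite I\<close>
proof (induction I rule: finite_induct)
  case empty
  show ?case by simp
next
  case (insert i I)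
  interpret \<mu>: prob_space \<mu> by fact
  interpret product_sigma_finite "\<lambda>_. \<mu>" ..
  interpret PI: prob_space "PiM I (\<lambda>_. \<mu>)" by (rule prob_space_PiM) (rule \<mu>)
  interpret PiI: prob_space "PiM (insert i I) (\<lambda>_. \<mu>)" by (rule prob_space_PiM) (rule \<mu>)
  have B: "\<bar>\<Sum>i\<in>J. \<psi> (x i)\<bar> \<le> real (card J) * B" for J and x :: "'b \<Rightarrow> 'a"
    by (rule order_trans[OF sum_abs order_trans[OF sum_mono[of J _ "\<lambda>_. B"]]]) (auto simp: bd)
  have sq: "(\<Sum>i\<in>J. \<psi> (x i))\<^sup>2 \<le> (real (card J) * B)\<^sup>2" for J and x :: "'b \<Rightarrow> 'a"
    using power_mono[OF B[of x J], of 2] by simp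
  have int1: "integrable \<mu> \<psi>"
    by (rule \<mu>.integrable_const_bound[where B = B]) (auto simp: bd)
  have int2: "integrable \<mu> (\<lambda>x. (\<psi> x)\<^sup>2)"
    by (rule \<mu>.integrable_const_bound[where B = "B\<^sup>2"]) (use power_mono[OF bd, where n = 2] in auto)
  have intI: "integrable (PiM J (\<lambda>_. \<mu>)) (\<lambda>x. (\<Sum>i\<in>J. \<psi> (x i))\<^sup>2)" for J :: "'b set"
  proof -
    interpret PJ: prob_space "PiM J (\<lambda>_. \<mu>)" by (rule prob_space_PiM) (rule \<mu>)
    show ?thesis
      by (rule PJ.integrable_const_bound[where B = "(real (card J) * B)\<^sup>2"]) (auto simp: sq)
  qed
  have "(\<integral>x. (\<Sum>j\<in>insert i I. \<psi> (x j))\<^sup>2 \<partial>PiM (insert i I) (\<lambda>_. \<mu>))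
     = (\<integral>x. (\<integral>y. (\<Sum>j\<in>insert i I. \<psi> ((x(i := y)) j))\<^sup>2 \<partial>\<mu>) \<partial>PiM I (\<lambda>_. \<mu>))"
    by (rule product_integral_insert[OF insert.hyps intI])
  also have "\<dots> = (\<integral>x. (\<Sum>j\<in>I. \<psi> (x j))\<^sup>2 + (\<integral>y. (\<psi> y)\<^sup>2 \<partial>\<mu>) \<partial>PiM I (\<lambda>_. \<mu>))"
  proof (intro Bochner_Integration.integral_cong refl)
    fix x :: "'b \<Rightarrow> 'a"
    define s where "s = (\<Sum>j\<in>I. \<psi> (x j))"
    have "(\<Sum>j\<in>insert i I. \<psi> ((x(i := y)) j)) = \<psi> y + s" for y
      unfolding s_def using insert.hyps by (auto intro!: sum.cong)
    then have "(\<integral>y. (\<Sum>j\<in>insert i I. \<psi> ((x(i := y)) j))\<^sup>2 \<partial>\<mu>) = (\<integral>y. ((\<psi> y)\<^sup>2 + (2 * s) * \<psi> y) + s\<^sup>2 \<partial>\<mu>)"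
      by (intro Bochner_Integration.integral_cong refl) (simp add: power2_sum)
    also have "\<dots> = s\<^sup>2 + (\<integral>y. (\<psi> y)\<^sup>2 \<partial>\<mu>)"
      using int1 int2 by (simp add: mean \<mu>.prob_space)
    finally show "(\<integral>y. (\<Sum>j\<in>insert i I. \<psi> ((x(i := y)) j))\<^sup>2 \<partial>\<mu>) = s\<^sup>2 + (\<integral>y. (\<psi> y)\<^sup>2 \<partial>\<mu>)" .
  qed
  also have "\<dots> = real (card (insert i I)) * (\<integral>x. (\<psi> x)\<^sup>2 \<partial>\<mu>)"
    using insert.hyps intI by (simp add: insert.IH PI.prob_space algebra_simps)
  finally show ?case .
qed

text \<open>
  The global bound B provides integrability only; the estimate depends on the almost sure bound H,
  which is the one that decays when the lemma is applied pointwise to a family of functions.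
\<close>

lemma iid_mean_abs_deviation:
  fixes \<phi> :: "'a \<Rightarrow> real"
  assumes \<mu>: "prob_space \<mu>" and n: "n \<ge> 1" and m[measurable]: "\<phi> \<in> borel_measurable \<mu>"
    and bd: "\<And>x. \<bar>\<phi> x\<bar> \<le> B" and H: "AE x in \<mu>. \<bar>\<phi> x\<bar> \<le> H" and H0: "H \<ge> 0"
  shows "(\<integral>\<^sup>+x. ennreal \<bar>(\<Sum>i<n. \<phi> (x i)) / real n - (\<integral>x. \<phi> x \<partial>\<mu>)\<bar> \<partial>PiM {..<n} (\<lambda>_. \<mu>)) \<le> ennreal (H / sqrt (real n))"
proof -
  interpret \<mu>: prob_space \<mu> by fact
  interpret P: prob_space "PiM {..<n} (\<lambda>_. \<mu>)" by (rule prob_space_PiM) (rule \<mu>)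
  define e where "e = (\<integral>x. \<phi> x \<partial>\<mu>)"
  define \<psi> where "\<psi> x = \<phi> x - e" for x
  define Y where "Y x = (\<Sum>i<n. \<phi> (x i)) / real n - e" for x
  have [measurable]: "\<psi> \<in> borel_measurable \<mu>" unfolding \<psi>_def by measurable
  have [measurable]: "Y \<in> borel_measurable (PiM {..<n} (\<lambda>_. \<mu>))" unfolding Y_def by measurable
  have int1: "integrable \<mu> \<phi>"
    by (rule \<mu>.integrable_const_bound[where B = B]) (auto simp: bd)
  have int2: "integrable \<mu> (\<lambda>x. (\<phi> x)\<^sup>2)"
    by (rule \<mu>.integrable_const_bound[where B = "B\<^sup>2"]) (use power_mono[OF bd, where n = 2] in auto)
  have B\<psi>: "\<bar>\<psi> x\<bar> \<le> B + \<bar>e\<bar>" for x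
    using bd[of x] by (simp add: \<psi>_def abs_if split: if_splits)
  have mean: "(\<integral>x. \<psi> x \<partial>\<mu>) = 0"
    unfolding \<psi>_def using int1 by (simp add: e_def \<mu>.prob_space)
  have YS: "Y x = (\<Sum>i<n. \<psi> (x i)) / real n" for x
    using n by (simp add: Y_def \<psi>_def sum_subtractf diff_divide_distrib)
  have BY: "\<bar>Y x\<bar> \<le> B + \<bar>e\<bar>" for x
  proof -
    have "\<bar>\<Sum>i<n. \<psi> (x i)\<bar> \<le> (\<Sum>i<n. B + \<bar>e\<bar>)"
      by (rule order_trans[OF sum_abs sum_mono]) (rule B\<psi>)
    then show ?thesis using n by (simp add: YS field_simps)
  qed
  have intY: "integrable (PiM {..<n} (\<lambda>_. \<mu>)) (\<lambda>x. \<bar>Y x\<bar>)"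
    by (rule P.integrable_const_bound[where B = "B + \<bar>e\<bar>"]) (auto simp: BY)
  have intY2: "integrable (PiM {..<n} (\<lambda>_. \<mu>)) (\<lambda>x. \<bar>Y x\<bar>\<^sup>2)"
    by (rule P.integrable_const_bound[where B = "(B + \<bar>e\<bar>)\<^sup>2"]) (use power_mono[OF BY, where n = 2] in auto)
  have "(\<integral>x. (\<psi> x)\<^sup>2 \<partial>\<mu>) = (\<integral>x. (\<phi> x)\<^sup>2 \<partial>\<mu>) - e\<^sup>2"
    using \<mu>.variance_eq[OF int1 int2] by (simp add: \<psi>_def e_def)
  also have "\<dots> \<le> (\<integral>x. (\<phi> x)\<^sup>2 \<partial>\<mu>)" by simp
  also have "\<dots> \<le> H\<^sup>2"
    by (rule \<mu>.integral_le_const[OF int2], use H in eventually_elim) (metis abs_ge_zero power2_abs power_mono)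
  finally have v: "(\<integral>x. (\<psi> x)\<^sup>2 \<partial>\<mu>) \<le> H\<^sup>2" .
  have "(\<integral>x. \<bar>Y x\<bar> \<partial>PiM {..<n} (\<lambda>_. \<mu>))\<^sup>2 \<le> (\<integral>x. \<bar>Y x\<bar>\<^sup>2 \<partial>PiM {..<n} (\<lambda>_. \<mu>))"
    using P.variance_eq[OF intY intY2] P.variance_positive[of "\<lambda>x. \<bar>Y x\<bar>"] by simp
  also have "\<dots> = (\<integral>x. (\<Sum>i<n. \<psi> (x i))\<^sup>2 \<partial>PiM {..<n} (\<lambda>_. \<mu>)) / (real n)\<^sup>2"
    by (simp add: YS power_divide)
  also have "\<dots> = real n * (\<integral>x. (\<psi> x)\<^sup>2 \<partial>\<mu>) / (real n)\<^sup>2"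
    by (subst iid_second_moment[OF \<mu> _ _ B\<psi> mean]) auto
  also have "\<dots> = (\<integral>x. (\<psi> x)\<^sup>2 \<partial>\<mu>) / real n"
    using n by (simp add: power2_eq_square)
  also have "\<dots> \<le> H\<^sup>2 / real n"
    by (intro divide_right_mono v) simp
  also have "\<dots> = (H / sqrt (real n))\<^sup>2"
    by (simp add: power_divide)
  finally have "(\<integral>x. \<bar>Y x\<bar> \<partial>PiM {..<n} (\<lambda>_. \<mu>)) \<le> H / sqrt (real n)"
    by (rule power2_le_imp_le) (simp add: H0)
  then show ?thesis
    unfolding e_def[symmetric] Y_def[symmetric]
    by (subst nn_integral_eq_integral[OF intY]) (auto intro!: ennreal_leI)
qed

section \<open>Concentration and mean of the smoothed distance\<close>

context bounded_smoothing_density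
begin

text \<open>
  The bounded-difference inequality asks for small differences at all points, but changing a sample point has
  a controlled effect only inside the support. Sending all points outside the support to a fixed point
  of it changes the distance on a null set only and enforces the bound everywhere.
\<close>

lemma smooth_wasserstein1_reduction:
  assumes n: "n \<ge> 1" and \<mu>: "\<mu> \<in> P1" and bS: "bounded (supp \<mu>)"
  obtains f where "f \<in> borel_measurable (PiM {..<n} (\<lambda>_. \<mu>))"
    and "AE x in PiM {..<n} (\<lambda>_. \<mu>). f x = smooth_wasserstein1 G (empirical_measure n x) \<mu>"
    and "\<And>x i y. i < n \<Longrightarrow> \<bar>f x - f (x(i := y))\<bar> \<le> diameter (supp \<mu>) / real n"
    and "\<And>x y. \<bar>f x - f y\<bar> \<le> diameter (supp \<mu>)"
proof -
  have s\<mu>[measurable_cong]: "sets \<mu> = sets borel" and p\<mu>: "prob_space \<mu>" using \<mu> by (simp_all add: P1_def)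
  define S where "S = supp \<mu>"
  have [measurable]: "S \<in> sets borel" unfolding S_def by (intro borel_closed closed_supp)
  obtain a where a: "a \<in> S" using supp_nonempty[OF p\<mu> s\<mu>] by (auto simp: S_def)
  define proj where "proj u = (if u \<in> S then u else a)" for u
  have projS: "proj u \<in> S" for u using a by (simp add: proj_def)
  have [measurable]: "proj \<in> borel_measurable borel" unfolding proj_def by measurable
  define L where "L x = smooth_wasserstein1 G (empirical_measure n x) \<mu>" for x
  have lip: "\<bar>L x - L y\<bar> \<le> (\<Sum>i<n. norm (x i - y i)) / real n" for x y
    unfolding L_def by (rule smooth_wasserstein1_lipschitz[OF n \<mu>])
  have Lm[measurable]: "L \<in> borel_measurable (PiM {..<n} (\<lambda>_. \<mu>))"
    unfolding L_def by (rule smooth_wasserstein1_measurable[OF n \<mu>])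
  have d: "norm (proj u - proj v) \<le> diameter S" for u v
    using diameter_bounded_bound[OF _ projS[of u] projS[of v]] bS by (simp add: S_def dist_norm)
  define f where "f x = L (\<lambda>i\<in>{..<n}. proj (x i))" for x
  have f_lip: "\<bar>f x - f y\<bar> \<le> (\<Sum>i<n. norm (proj (x i) - proj (y i))) / real n" for x y
    using lip[of "\<lambda>i\<in>{..<n}. proj (x i)" "\<lambda>i\<in>{..<n}. proj (y i)"] by (simp add: f_def)
  show ?thesis
  proof
    have "(\<lambda>x. \<lambda>i\<in>{..<n}. proj (x i)) \<in> measurable (PiM {..<n} (\<lambda>_. \<mu>)) (PiM {..<n} (\<lambda>_. \<mu>))"
      by (rule measurable_restrict) measurable
    from measurable_compose[OF this Lm] show "f \<in> borel_measurable (PiM {..<n} (\<lambda>_. \<mu>))"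
      by (simp add: f_def[abs_def])
    have "AE x in PiM {..<n} (\<lambda>_. \<mu>). \<forall>i\<in>{..<n}. x i \<in> S"
      by (intro AE_finite_allI AE_PiM_component) (use p\<mu> AE_in_supp[OF s\<mu>] in \<open>auto simp: S_def\<close>)
    with AE_space show "AE x in PiM {..<n} (\<lambda>_. \<mu>). f x = smooth_wasserstein1 G (empirical_measure n x) \<mu>"
    proof eventually_elim
      case (elim x)
      then have "(\<lambda>i\<in>{..<n}. proj (x i)) = x"
        by (intro ext) (auto simp: space_PiM PiE_def extensional_def proj_def)
      then show ?case by (simp add: f_def L_def)
    qed
    show "\<bar>f x - f (x(i := y))\<bar> \<le> diameter (supp \<mu>) / real n" if i: "i < n" for x i y
    proof -
      have "(\<Sum>j<n. norm (proj (x j) - proj ((x(i := y)) j)))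
          = (\<Sum>j<n. if j = i then norm (proj (x i) - proj y) else 0)"
        by (intro sum.cong) auto
      also have "\<dots> = norm (proj (x i) - proj y)" using i by simp
      also have "\<dots> \<le> diameter S" by (rule d)
      finally show ?thesis
        using f_lip[of x "x(i := y)"] unfolding S_def
        by (meson divide_right_mono of_nat_0_le_iff order_trans)
    qed
    show "\<bar>f x - f y\<bar> \<le> diameter (supp \<mu>)" for x y
    proof -
      have "(\<Sum>i<n. norm (proj (x i) - proj (y i))) \<le> (\<Sum>i<n. diameter S)"
        by (intro sum_mono d)
      then have "(\<Sum>i<n. norm (proj (x i) - proj (y i))) / real n \<le> diameter S"
        using n by (simp add: field_simps)
      with f_lip[of x y] show ?thesis by (simp add: S_def)
    qed
  qed
qed

text \<open>
  Each of the n differences is at most D / n, where D is the diameter, so the sum of their squares is D^2 / n.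
\<close>

lemma smooth_wasserstein1_concentration:
  assumes n: "n \<ge> 1" and \<mu>: "\<mu> \<in> P1" and bS: "bounded (supp \<mu>)" and t: "t > 0"
  shows "\<P>(x in PiM {..<n} (\<lambda>_. \<mu>).
               \<bar>smooth_wasserstein1 G (empirical_measure n x) \<mu>
                 - (\<integral>y. smooth_wasserstein1 G (empirical_measure n y) \<mu> \<partial>PiM {..<n} (\<lambda>_. \<mu>))\<bar> \<ge> t)
            \<le> (if diameter (supp \<mu>) = 0 then 0
               else 2 * exp (- (2 * t\<^sup>2 * real n / (diameter (supp \<mu>))\<^sup>2)))"
proof -
  define D where "D = diameter (supp \<mu>)"
  have p\<mu>: "prob_space \<mu>" using \<mu> by (simp_all add: P1_def)
  define PM where "PM = PiM {..<n} (\<lambda>_. \<mu>)"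
  interpret P: prob_space PM unfolding PM_def by (rule prob_space_PiM) (rule p\<mu>)
  define L where "L x = smooth_wasserstein1 G (empirical_measure n x) \<mu>" for x
  have Lm[measurable]: "L \<in> borel_measurable PM"
    unfolding L_def PM_def by (rule smooth_wasserstein1_measurable[OF n \<mu>])
  obtain f where fm[measurable]: "f \<in> borel_measurable PM" and ae: "AE x in PM. f x = L x"
    and diff: "\<And>x i y. i < n \<Longrightarrow> \<bar>f x - f (x(i := y))\<bar> \<le> D / real n"
    and osc: "\<And>x y. \<bar>f x - f y\<bar> \<le> D"
    using smooth_wasserstein1_reduction[OF n \<mu> bS] unfolding PM_def L_def D_def by blast
  have "(\<integral>x. L x \<partial>PM) = (\<integral>x. f x \<partial>PM)"
    by (rule integral_cong_AE) (use ae in \<open>auto simp: eq_commute\<close>)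
  then have "\<P>(x in PM. \<bar>L x - (\<integral>y. L y \<partial>PM)\<bar> \<ge> t) = \<P>(x in PM. \<bar>f x - (\<integral>y. f y \<partial>PM)\<bar> \<ge> t)"
    by (intro measure_eq_AE) (use ae in \<open>auto\<close>)
  also have "\<dots> \<le> (if D = 0 then 0 else 2 * exp (- (2 * t\<^sup>2 * real n / D\<^sup>2)))"
  \<comment> \<open>A one-point support makes the distance almost surely constant, and the sum of squares vanishes.\<close>
  proof (cases "D = 0")
    case True
    define c where "c = f undefined"
    have "f x = c" for x using osc[of x undefined] True by (simp add: c_def)
    then have "{x \<in> space PM. \<bar>f x - (\<integral>y. f y \<partial>PM)\<bar> \<ge> t} = {}"
      using t by (simp add: P.prob_space)
    then show ?thesis using True by (simp only: measure_empty) simp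
  next
    case False
    then have D: "D > 0" using osc[of undefined undefined] by simp
    have V: "(\<Sum>i<n. (D / real n)\<^sup>2) = D\<^sup>2 / real n"
      using n by (simp add: power_divide power2_eq_square)
    have "\<P>(x in PM. \<bar>f x - (\<integral>y. f y \<partial>PM)\<bar> \<ge> t) \<le> 2 * exp (- (2 * t\<^sup>2 / (\<Sum>i<n. (D / real n)\<^sup>2)))"
      unfolding PM_def
    proof (rule mcdiarmid[where B = "\<bar>f undefined\<bar> + D"])
      show "\<bar>f x\<bar> \<le> \<bar>f undefined\<bar> + D" for x using osc[of x undefined] by linarith
      show "0 < (\<Sum>i<n. (D / real n)\<^sup>2)" unfolding V using D n by simp
    qed (use p\<mu> fm diff t in \<open>auto simp: PM_def\<close>)
    also have "2 * t\<^sup>2 / (\<Sum>i<n. (D / real n)\<^sup>2) = 2 * t\<^sup>2 * real n / D\<^sup>2"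
      unfolding V by simp
    finally show ?thesis using False by simp
  qed
  finally show ?thesis unfolding L_def PM_def D_def .
qed

text \<open>
  At each z the density of the smoothed empirical measure is the average of the independent variables
  \<gamma> (z - X i), whose mean is the density of the smoothed \<mu>. Its expected deviation is thus at most
  H z / sqrt n, and integrating this against norm z bounds the expected cost of the coupling that moves
  only the difference of the densities.
\<close>

lemma expected_smooth_wasserstein1_le:
  assumes n: "n \<ge> 1" and \<mu>: "\<mu> \<in> P1"
    and Hm[measurable]: "H \<in> borel_measurable borel" and H0: "\<And>z. H z \<ge> 0"
    and H: "\<And>z. AE x in \<mu>. \<gamma> (z - x) \<le> H z"
    and B: "(\<integral>\<^sup>+z. ennreal (norm z * H z) \<partial>lborel) \<le> ennreal B" and B0: "B \<ge> 0"
  shows "(\<integral>x. smooth_wasserstein1 G (empirical_measure n x) \<mu> \<partial>PiM {..<n} (\<lambda>_. \<mu>)) \<le> B / sqrt (real n)"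
proof -
  have s\<mu>[measurable_cong]: "sets \<mu> = sets borel" and p\<mu>: "prob_space \<mu>" using \<mu> by (simp_all add: P1_def)
  define PM where "PM = PiM {..<n} (\<lambda>_. \<mu>)"
  interpret P: prob_space PM unfolding PM_def by (rule prob_space_PiM) (rule p\<mu>)
  interpret pair_sigma_finite PM "lborel :: 'a measure" ..
  define L where "L x = smooth_wasserstein1 G (empirical_measure n x) \<mu>" for x
  have Lm[measurable]: "L \<in> borel_measurable PM"
    unfolding L_def PM_def by (rule smooth_wasserstein1_measurable[OF n \<mu>])
  have E: "prob_space (empirical_measure n x)" "sets (empirical_measure n x) = sets borel" for x :: "nat \<Rightarrow> 'a"
    using empirical_measure_in_P1[OF n, of x] by (auto simp: P1_def)
  note [measurable] = measurable_smoothed[OF p\<mu> s\<mu>]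
  define dev where "dev x z = \<bar>(\<Sum>i<n. \<gamma> (z - x i)) / real n - smoothed \<mu> z\<bar>" for x z
  have devm[measurable]: "(\<lambda>(x, z). dev x z) \<in> borel_measurable (PM \<Otimes>\<^sub>M lborel)"
  proof -
    have [measurable]: "(\<lambda>x. x i) \<in> measurable PM borel" if "i \<in> {..<n}" for i
      unfolding PM_def using that by measurable
    show ?thesis unfolding dev_def by measurable
  qed
  have dev_nonneg: "dev x z \<ge> 0" for x z by (simp add: dev_def)
  have le: "ennreal (L x) \<le> (\<integral>\<^sup>+z. ennreal (norm z * dev x z) \<partial>lborel)" for x
  proof -
    have "ennreal (L x) \<le> wasserstein1 (convolution (empirical_measure n x) G) (convolution \<mu> G)"
      by (simp add: L_def smooth_wasserstein1_def ennreal_enn2real_if)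
    also have "\<dots> \<le> (\<integral>\<^sup>+z. ennreal (norm z * \<bar>smoothed (empirical_measure n x) z - smoothed \<mu> z\<bar>) \<partial>lborel)"
      unfolding convolution_eq_density[OF E] convolution_eq_density[OF p\<mu> s\<mu>]
      by (intro wasserstein1_le_weighted_l1 smoothed_nonneg measurable_smoothed E p\<mu> s\<mu>)
         (use convolution_kernel_in_P1[OF \<mu>] convolution_kernel_in_P1[OF empirical_measure_in_P1[OF n, of x]] in
          \<open>auto simp: P1_def convolution_eq_density[OF E] convolution_eq_density[OF p\<mu> s\<mu>]\<close>)
    finally show ?thesis by (simp add: smoothed_empirical[OF n] dev_def)
  qed
  have "(\<integral>\<^sup>+x. ennreal (L x) \<partial>PM) \<le> (\<integral>\<^sup>+x. \<integral>\<^sup>+z. ennreal (norm z * dev x z) \<partial>lborel \<partial>PM)"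
    by (intro nn_integral_mono le)
  also have "\<dots> = (\<integral>\<^sup>+z. \<integral>\<^sup>+x. ennreal (norm z * dev x z) \<partial>PM \<partial>lborel)"
    by (rule Fubini'[symmetric]) measurable
  also have "\<dots> \<le> (\<integral>\<^sup>+z. ennreal (1 / sqrt (real n)) * ennreal (norm z * H z) \<partial>lborel)"
  proof (rule nn_integral_mono)
    fix z :: 'a
    have "(\<integral>\<^sup>+x. ennreal (norm z * dev x z) \<partial>PM) = ennreal (norm z) * (\<integral>\<^sup>+x. ennreal (dev x z) \<partial>PM)"
      by (subst nn_integral_cmult[symmetric]) (simp_all add: ennreal_mult dev_nonneg)
    also have "(\<integral>\<^sup>+x. ennreal (dev x z) \<partial>PM) \<le> ennreal (H z / sqrt (real n))"
      unfolding dev_def smoothed_def PM_def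
    proof (rule iid_mean_abs_deviation[OF p\<mu> n, where B = C])
      show "(\<lambda>x. \<gamma> (z - x)) \<in> borel_measurable \<mu>" by measurable
    qed (use H[of z] H0 in \<open>auto simp: \<gamma>_nonneg \<gamma>_le\<close>)
    also have "ennreal (norm z) * ennreal (H z / sqrt (real n)) = ennreal (1 / sqrt (real n)) * ennreal (norm z * H z)"
      using H0[of z] by (simp add: flip: ennreal_mult)
    finally show "(\<integral>\<^sup>+x. ennreal (norm z * dev x z) \<partial>PM) \<le> ennreal (1 / sqrt (real n)) * ennreal (norm z * H z)"
      by (simp add: mult_left_mono)
  qed
  also have "\<dots> = ennreal (1 / sqrt (real n)) * (\<integral>\<^sup>+z. ennreal (norm z * H z) \<partial>lborel)"
    by (rule nn_integral_cmult) measurable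
  also have "\<dots> \<le> ennreal (1 / sqrt (real n)) * ennreal B"
    by (intro mult_left_mono B) simp
  also have "\<dots> = ennreal (B / sqrt (real n))"
    using B0 by (simp flip: ennreal_mult)
  finally have "(\<integral>\<^sup>+x. ennreal (L x) \<partial>PM) \<le> ennreal (B / sqrt (real n))" .
  then have "(\<integral>x. L x \<partial>PM) \<le> B / sqrt (real n)"
    by (subst integral_eq_nn_integral)
       (use B0 in \<open>auto simp: L_def smooth_wasserstein1_def intro!: enn2real_leI\<close>)
  then show ?thesis by (simp add: L_def PM_def)
qed

text \<open>
  Eventually a n exceeds K log n / sqrt n for any given K. Large K makes a n / 2 at least the mean, so that
  the concentration bound applies with t = a n / 2, and it makes the exponent at least 2 (log n)^2.
\<close>

lemma smooth_wasserstein1_tail: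
  fixes a :: "nat \<Rightarrow> real"
  assumes \<mu>: "\<mu> \<in> P1" and bS: "bounded (supp \<mu>)"
    and B: "\<And>n. n \<ge> 1 \<Longrightarrow>
       (\<integral>x. smooth_wasserstein1 G (empirical_measure n x) \<mu> \<partial>PiM {..<n} (\<lambda>_. \<mu>)) \<le> B / sqrt (real n)"
    and B0: "B \<ge> 0"
    and a: "filterlim (\<lambda>n. a n / (ln (real n) / sqrt (real n))) at_top sequentially"
  shows "\<forall>\<^sub>F n in sequentially.
     \<P>(x in PiM {..<n} (\<lambda>_. \<mu>). smooth_wasserstein1 G (empirical_measure n x) \<mu> \<ge> a n) \<le> real n powr (- 1)"
proof -
  define D where "D = diameter (supp \<mu>)"
  have p\<mu>: "prob_space \<mu>" using \<mu> by (simp_all add: P1_def)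
  have D0: "D \<ge> 0" unfolding D_def by (rule diameter_ge_0[OF bS])
  \<comment> \<open>The part 2 B serves the comparison with the mean, 2 D the exponent, and 1 makes K positive.\<close>
  define K where "K = 2 * B + 2 * D + 1"
  have "\<forall>\<^sub>F n in sequentially. K \<le> a n / (ln (real n) / sqrt (real n))"
    using a by (simp add: filterlim_at_top)
  then show ?thesis
    using eventually_ge_at_top[of 3]
  proof eventually_elim
    case (elim n)
    then have n: "n \<ge> 1" by simp
    define PM where "PM = PiM {..<n} (\<lambda>_. \<mu>)"
    interpret P: prob_space PM unfolding PM_def by (rule prob_space_PiM) (rule p\<mu>)
    define L where "L x = smooth_wasserstein1 G (empirical_measure n x) \<mu>" for x
    have Lm[measurable]: "L \<in> borel_measurable PM"
      unfolding L_def PM_def by (rule smooth_wasserstein1_measurable[OF n \<mu>])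
    have "exp 1 \<le> real n" using exp_le elim(2) by (meson numeral_le_real_of_nat_iff order_trans)
    then have ln1: "ln (real n) \<ge> 1" using n by (subst ln_ge_iff) auto
    have sq: "sqrt (real n) > 0" using n by simp
    have Kl: "K * ln (real n) \<le> a n * sqrt (real n)"
      using elim(1) ln1 sq by (simp add: field_simps)
    have K0: "K > 0" using B0 D0 by (simp add: K_def)
    have as: "K \<le> a n * sqrt (real n)"
      using mult_left_mono[OF ln1, of K] K0 Kl by linarith
    then have "a n * sqrt (real n) > 0" using K0 by linarith
    then have a0: "a n > 0" using sq by (simp add: zero_less_mult_iff)
    have "2 * B \<le> a n * sqrt (real n)" using as D0 by (simp add: K_def)
    then have "B / sqrt (real n) \<le> a n / 2" using sq by (simp add: field_simps)
    then have EL: "(\<integral>x. L x \<partial>PM) \<le> a n / 2" using B[OF n] unfolding L_def PM_def by (rule order_trans[rotated])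
    have "\<P>(x in PM. L x \<ge> a n) \<le> \<P>(x in PM. \<bar>L x - (\<integral>y. L y \<partial>PM)\<bar> \<ge> a n / 2)"
    proof (rule P.finite_measure_mono)
      have "\<bar>L x - (\<integral>y. L y \<partial>PM)\<bar> \<ge> a n / 2" if "L x \<ge> a n" for x
        using that EL by linarith
      then show "{x \<in> space PM. L x \<ge> a n} \<subseteq> {x \<in> space PM. \<bar>L x - (\<integral>y. L y \<partial>PM)\<bar> \<ge> a n / 2}"
        by blast
    qed measurable
    also have "\<dots> \<le> (if D = 0 then 0 else 2 * exp (- (2 * (a n / 2)\<^sup>2 * real n / D\<^sup>2)))"
      unfolding L_def PM_def D_def by (rule smooth_wasserstein1_concentration[OF n \<mu> bS]) (use a0 in simp)
    also have "\<dots> \<le> real n powr (- 1)"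
    proof (cases "D = 0")
      case False
      then have D: "D > 0" using D0 by simp
      have "2 * D * ln (real n) \<le> K * ln (real n)"
        using ln1 B0 by (intro mult_right_mono) (auto simp: K_def)
      then have "(2 * D * ln (real n))\<^sup>2 \<le> (a n * sqrt (real n))\<^sup>2"
        using Kl D ln1 by (intro power_mono order_trans[OF _ Kl]) auto
      then have "4 * D\<^sup>2 * (ln (real n))\<^sup>2 \<le> (a n)\<^sup>2 * real n"
        by (simp add: power_mult_distrib)
      then have "2 * (ln (real n))\<^sup>2 \<le> 2 * (a n / 2)\<^sup>2 * real n / D\<^sup>2"
        using D by (simp add: field_simps)
      moreover have "ln (real n) * 1 \<le> ln (real n) * ln (real n)"
        using ln1 by (intro mult_left_mono) auto
      ultimately have "2 * ln (real n) \<le> 2 * (a n / 2)\<^sup>2 * real n / D\<^sup>2"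
        by (simp add: power2_eq_square)
      then have "2 * exp (- (2 * (a n / 2)\<^sup>2 * real n / D\<^sup>2)) \<le> 2 * exp (- (2 * ln (real n)))"
        by simp
      also have "exp (- (2 * ln (real n))) = 1 / (real n * real n)"
        using n by (simp add: exp_minus exp_double power2_eq_square inverse_eq_divide)
      also have "2 * (1 / (real n * real n)) \<le> 1 / real n"
        using elim(2) by (simp add: field_simps)
      also have "\<dots> = real n powr (- 1)" using n by (simp add: powr_minus inverse_eq_divide)
      finally show ?thesis using False by simp
    qed simp
    finally show ?case by (simp add: L_def PM_def)
  qed
qed

end

section \<open>An integrable envelope for product densities with unimodal factors\<close>

lemma nn_integral_lborel_cart_prod:
  fixes f :: "real \<Rightarrow> real"
  assumes [measurable]: "f \<in> borel_measurable borel" and "\<And>t. f t \<ge> 0"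
  shows "(\<integral>\<^sup>+z. ennreal (\<Prod>j\<in>UNIV. f (z $ j)) \<partial>(lborel :: (real ^ 'd) measure)) = (\<integral>\<^sup>+t. ennreal (f t) \<partial>lborel) ^ CARD('d)"
proof -
  have B: "(Basis :: (real ^ 'd) set) = range (\<lambda>j. axis j 1)"
    by (auto simp: Basis_vec_def)
  have inj: "inj (\<lambda>j :: 'd. axis j (1::real))"
    by (auto simp: inj_def axis_eq_axis)
  have "(\<integral>\<^sup>+z. ennreal (\<Prod>j\<in>UNIV. f (z $ j)) \<partial>(lborel :: (real ^ 'd) measure))
      = (\<integral>\<^sup>+z. (\<Prod>b\<in>Basis. ennreal (f (z \<bullet> b))) \<partial>(lborel :: (real ^ 'd) measure))"
    unfolding B by (subst prod.reindex[OF inj]) (simp add: prod_ennreal assms inner_axis)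
  also have "\<dots> = (\<Prod>b\<in>(Basis :: (real ^ 'd) set). (\<integral>\<^sup>+t. ennreal (f t) \<partial>lborel))"
    by (subst nn_integral_lborel_prod) auto
  finally show ?thesis by simp
qed

lemma norm_le_prod_one_plus_abs:
  fixes z :: "real ^ 'd"
  shows "norm z \<le> (\<Prod>j\<in>UNIV. 1 + \<bar>z $ j\<bar>)"
proof -
  have "norm z \<le> (\<Sum>j\<in>UNIV. \<bar>z $ j\<bar>)" by (rule norm_le_l1_cart)
  also have "\<dots> \<le> (\<Prod>j\<in>UNIV. 1 + \<bar>z $ j\<bar>)" by (rule sum_le_prod) auto
  finally show ?thesis .
qed

text \<open>
  For g decreasing away from 0 this is the supremum of g (t - s) over all s with absolute value at most R:
  clamping t to the interval from -R to R gives the admissible s that brings t - s closest to 0.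
\<close>

definition unimodal_envelope :: "real \<Rightarrow> (real \<Rightarrow> real) \<Rightarrow> real \<Rightarrow> real" where
  "unimodal_envelope R g t = g (t - max (- R) (min R t))"

lemma unimodal_envelope_ge:
  assumes mono: "\<And>s t::real. 0 \<le> s \<and> s \<le> t \<or> t \<le> s \<and> s \<le> 0 \<Longrightarrow> g t \<le> (g s :: real)"
    and "\<bar>s\<bar> \<le> R"
  shows "g (t - s) \<le> unimodal_envelope R g t"
  unfolding unimodal_envelope_def by (rule mono) (use \<open>\<bar>s\<bar> \<le> R\<close> in \<open>auto simp: max_def min_def\<close>)

text \<open>
  On the central interval the envelope is the constant g 0, and on either side it is a translate of g.
\<close>

lemma unimodal_envelope_first_moment:
  assumes gm[measurable]: "g \<in> borel_measurable borel" and g0: "\<And>s. 0 \<le> g s"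
    and mass: "(\<integral>\<^sup>+s. ennreal (g s) \<partial>lborel) = 1"
    and moment: "(\<integral>\<^sup>+s. ennreal (g s) * ennreal \<bar>s\<bar> \<partial>lborel) < \<infinity>"
    and R: "R \<ge> 0"
  shows "(\<integral>\<^sup>+t. ennreal ((1 + \<bar>t\<bar>) * unimodal_envelope R g t) \<partial>lborel) < \<infinity>"
proof -
  let ?J = "\<integral>\<^sup>+s. ennreal (1 + R) * ennreal (g s) + ennreal (g s) * ennreal \<bar>s\<bar> \<partial>lborel"
  have J: "?J < \<infinity>"
    using mass moment by (simp add: nn_integral_add nn_integral_cmult)
  have shift: "(\<integral>\<^sup>+t. ennreal ((1 + \<bar>t\<bar>) * g (t - c)) \<partial>lborel) \<le> ?J" if c: "\<bar>c\<bar> \<le> R" for c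
  proof -
    have "(\<integral>\<^sup>+t. ennreal ((1 + \<bar>t\<bar>) * g (t - c)) \<partial>lborel) = (\<integral>\<^sup>+s. ennreal ((1 + \<bar>c + s\<bar>) * g s) \<partial>lborel)"
      using nn_integral_lborel_translate[of "\<lambda>t. ennreal ((1 + \<bar>t\<bar>) * g (t - c))" c] by simp
    also have "\<dots> \<le> ?J"
    proof (rule nn_integral_mono)
      fix s
      have "(1 + \<bar>c + s\<bar>) * g s \<le> ((1 + R) + \<bar>s\<bar>) * g s"
        using c by (intro mult_right_mono g0) auto
      then show "ennreal ((1 + \<bar>c + s\<bar>) * g s) \<le> ennreal (1 + R) * ennreal (g s) + ennreal (g s) * ennreal \<bar>s\<bar>"
        using R g0[of s] by (simp add: algebra_simps ennreal_leI flip: ennreal_mult ennreal_plus)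
    qed
    finally show ?thesis .
  qed
  have "(\<integral>\<^sup>+t. ennreal ((1 + \<bar>t\<bar>) * unimodal_envelope R g t) \<partial>lborel)
     \<le> (\<integral>\<^sup>+t. ennreal ((1 + R) * g 0) * indicator {-R..R} t
          + (ennreal ((1 + \<bar>t\<bar>) * g (t - R)) + ennreal ((1 + \<bar>t\<bar>) * g (t - (- R)))) \<partial>lborel)"
  proof (rule nn_integral_mono)
    fix t :: real
    consider "\<bar>t\<bar> \<le> R" | "t > R" | "t < - R" by linarith
    then show "ennreal ((1 + \<bar>t\<bar>) * unimodal_envelope R g t)
       \<le> ennreal ((1 + R) * g 0) * indicator {-R..R} t
          + (ennreal ((1 + \<bar>t\<bar>) * g (t - R)) + ennreal ((1 + \<bar>t\<bar>) * g (t - (- R))))"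
    proof cases
      case 1
      then have "ennreal ((1 + \<bar>t\<bar>) * unimodal_envelope R g t) \<le> ennreal ((1 + R) * g 0) * indicator {-R..R} t"
        using g0[of 0] by (auto simp: unimodal_envelope_def max_def min_def intro!: ennreal_leI mult_right_mono)
      then show ?thesis by (rule order_trans) simp
    next
      case 2
      then have "unimodal_envelope R g t = g (t - R)"
        using R by (simp add: unimodal_envelope_def max_def min_def)
      then show ?thesis by (simp add: add_increasing add_increasing2)
    next
      case 3
      then have "unimodal_envelope R g t = g (t - (- R))"
        using R by (simp add: unimodal_envelope_def max_def min_def)
      then show ?thesis by (simp add: add_increasing)
    qed
  qed
  also have "\<dots> = (\<integral>\<^sup>+t. ennreal ((1 + R) * g 0) * indicator {-R..R} t \<partial>lborel)
     + ((\<integral>\<^sup>+t. ennreal ((1 + \<bar>t\<bar>) * g (t - R)) \<partial>lborel) + (\<integral>\<^sup>+t. ennreal ((1 + \<bar>t\<bar>) * g (t - (- R))) \<partial>lborel))"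
    by (subst nn_integral_add, simp, simp, subst nn_integral_add) simp_all
  also have "\<dots> < \<infinity>"
    using le_less_trans[OF shift[of R] J] le_less_trans[OF shift[of "- R"] J] R
    by (simp add: nn_integral_cmult_indicator ennreal_mult_less_top)
  finally show ?thesis .
qed

section \<open>Concentration and tails for product smoothing\<close>

theorem corollary1:
  fixes \<sigma> K :: real
    and g :: "real \<Rightarrow> real"
    and G \<mu> :: "(real ^ 'd) measure"
  assumes "\<sigma> > 0" and "K > 0"
    and "G \<in> P1"
    and "G = density lborel (\<lambda>x. ennreal (\<Prod>j\<in>UNIV. g (x $ j)))"
    and "probability_density g"
    and "subgaussian \<sigma> (density lborel (\<lambda>s. ennreal (g s)))"
    and "bounded (range g)"
    and "\<And>s t. 0 \<le> s \<and> s \<le> t \<or> t \<le> s \<and> s \<le> 0 \<Longrightarrow> g t \<le> g s"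
    and "\<mu> \<in> P1"
    and "subgaussian K \<mu>"
    and "bounded (supp \<mu>)"
  shows "(\<forall>t>0. \<forall>n\<ge>1.
            \<P>(x in PiM {..<n} (\<lambda>_. \<mu>).
               \<bar>smooth_wasserstein1 G (empirical_measure n x) \<mu>
                 - (\<integral>y. smooth_wasserstein1 G (empirical_measure n y) \<mu> \<partial>PiM {..<n} (\<lambda>_. \<mu>))\<bar> \<ge> t)
            \<le> (if diameter (supp \<mu>) = 0 then 0
               else 2 * exp (- (2 * t\<^sup>2 * real n / (diameter (supp \<mu>))\<^sup>2))))
       \<and> (\<forall>a::nat \<Rightarrow> real.
            (\<forall>n\<ge>1. a n > 0) \<and> filterlim (\<lambda>n. a n / (ln (real n) / sqrt (real n))) at_top sequentially
            \<longrightarrow> (\<exists>k>0. \<forall>\<^sub>F n in sequentially.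
                  \<P>(x in PiM {..<n} (\<lambda>_. \<mu>).
                     smooth_wasserstein1 G (empirical_measure n x) \<mu> \<ge> a n)
                  \<le> real n powr (- k)))"
proof -
  note mono = assms(8)
  have g0: "0 \<le> g s" for s
    using assms(5) by (auto simp: probability_density_def)
  have gm[measurable]: "g \<in> borel_measurable borel"
    and mass: "(\<integral>\<^sup>+s. ennreal (g s) \<partial>lborel) = 1"
    using assms(5) by (auto simp: probability_density_def)
  have "g s \<le> g 0" for s by (rule mono) auto
  then interpret bounded_smoothing_density "\<lambda>x :: real ^ 'd. \<Prod>j\<in>UNIV. g (x $ j)" "g 0 ^ CARD('d)" G
  proof unfold_locales
    show "(\<Prod>j\<in>UNIV. g (z $ j)) \<le> g 0 ^ CARD('d)" if "\<And>s. g s \<le> g 0" for z :: "real ^ 'd"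
      using prod_mono[of UNIV "\<lambda>j. g (z $ j)" "\<lambda>_. g 0"] that g0 by simp
  qed (use assms(3,4) g0 in \<open>auto intro: prod_nonneg\<close>)
  have "density lborel (\<lambda>s. ennreal (g s)) \<in> P1"
    using assms(6) by (simp add: subgaussian_def)
  then have moment: "(\<integral>\<^sup>+s. ennreal (g s) * ennreal \<bar>s\<bar> \<partial>lborel) < \<infinity>"
    by (simp add: P1_def integrable_iff_bounded nn_integral_density)
  obtain R where R: "\<And>x. x \<in> supp \<mu> \<Longrightarrow> norm x \<le> R" and R0: "R \<ge> 0"
    using assms(11) unfolding bounded_pos by (auto intro: less_imp_le)
  define h where "h = unimodal_envelope R g"
  have hm[measurable]: "h \<in> borel_measurable borel" unfolding h_def unimodal_envelope_def by measurable
  have h0: "h t \<ge> 0" for t by (simp add: h_def unimodal_envelope_def g0)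
  \<comment> \<open>H dominates the translates of the density by all points of the support, a subset of the ball of
     radius R; it is a product, so its moment splits into one-dimensional integrals.\<close>
  define H where "H z = (\<Prod>j\<in>UNIV. h (z $ j))" for z :: "real ^ 'd"
  have H0: "H z \<ge> 0" for z unfolding H_def by (intro prod_nonneg) (simp add: h0)
  have Hm: "H \<in> borel_measurable borel" unfolding H_def by measurable
  have H: "AE x in \<mu>. (\<Prod>j\<in>UNIV. g ((z - x) $ j)) \<le> H z" for z
  proof -
    have "AE x in \<mu>. x \<in> supp \<mu>" by (rule AE_in_supp) (use assms(9) in \<open>simp add: P1_def\<close>)
    then show ?thesis
    proof eventually_elim
      case (elim x)
      have "\<bar>x $ j\<bar> \<le> R" for j using component_le_norm_cart[of x j] R[OF elim] by linarith
      then show ?case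
        unfolding H_def h_def by (intro prod_mono) (auto simp: g0 intro!: unimodal_envelope_ge mono)
    qed
  qed
  \<comment> \<open>The norm is at most the product of all 1 + abs (z $ j), which turns the weighted integral of H
     into a product as well.\<close>
  define B where "B = enn2real (\<integral>\<^sup>+z. ennreal (norm z * H z) \<partial>lborel)"
  have "(\<integral>\<^sup>+z. ennreal (norm z * H z) \<partial>lborel)
      \<le> (\<integral>\<^sup>+z. ennreal (\<Prod>j\<in>UNIV. (1 + \<bar>z $ j\<bar>) * h (z $ j)) \<partial>(lborel :: (real ^ 'd) measure))"
    by (intro nn_integral_mono ennreal_leI)
       (auto simp: prod.distrib H_def[symmetric] intro!: mult_right_mono norm_le_prod_one_plus_abs H0)
  also have "\<dots> = (\<integral>\<^sup>+t. ennreal ((1 + \<bar>t\<bar>) * h t) \<partial>lborel) ^ CARD('d)"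
    by (rule nn_integral_lborel_cart_prod) (auto simp: h0)
  also have "\<dots> < \<infinity>"
    using unimodal_envelope_first_moment[OF gm g0 mass moment R0] unfolding h_def by (simp add: power_less_top_ennreal)
  finally have B: "(\<integral>\<^sup>+z. ennreal (norm z * H z) \<partial>lborel) \<le> ennreal B"
    unfolding B_def by simp
  have B0: "B \<ge> 0" by (simp add: B_def)
  have mean: "(\<integral>x. smooth_wasserstein1 G (empirical_measure n x) \<mu> \<partial>PiM {..<n} (\<lambda>_. \<mu>)) \<le> B / sqrt (real n)"
    if "n \<ge> 1" for n
    by (rule expected_smooth_wasserstein1_le[OF that assms(9) Hm H0 H B B0])
  show ?thesis
  proof (intro conjI allI impI)
    fix t :: real and n :: nat
    assume "t > 0" "n \<ge> 1"
    then show "\<P>(x in PiM {..<n} (\<lambda>_. \<mu>).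
               \<bar>smooth_wasserstein1 G (empirical_measure n x) \<mu>
                 - (\<integral>y. smooth_wasserstein1 G (empirical_measure n y) \<mu> \<partial>PiM {..<n} (\<lambda>_. \<mu>))\<bar> \<ge> t)
            \<le> (if diameter (supp \<mu>) = 0 then 0
               else 2 * exp (- (2 * t\<^sup>2 * real n / (diameter (supp \<mu>))\<^sup>2)))"
      by (intro smooth_wasserstein1_concentration assms(9,11))
  next
    fix a :: "nat \<Rightarrow> real"
    assume "(\<forall>n\<ge>1. a n > 0) \<and> filterlim (\<lambda>n. a n / (ln (real n) / sqrt (real n))) at_top sequentially"
    then have a: "filterlim (\<lambda>n. a n / (ln (real n) / sqrt (real n))) at_top sequentially" ..
    show "\<exists>k>0. \<forall>\<^sub>F n in sequentially.
                  \<P>(x in PiM {..<n} (\<lambda>_. \<mu>).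
                     smooth_wasserstein1 G (empirical_measure n x) \<mu> \<ge> a n)
                  \<le> real n powr (- k)"
      using smooth_wasserstein1_tail[OF assms(9,11) mean B0 a] by (intro exI[of _ 1]) simp
  qed
qed

end
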